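(* If $G$ is a finite nilpotent totally $2$-closed group, then $G$ is cyclic or $G$ is a direct product of a generalized quaternion group with a cyclic group of odd order.
   Context: If a group $G$ acts faithfully on a finite set $\Omega$ (a faithful $G$-set), then $G$ is identified with its image in $\mathrm{Sym}(\Omega)$, and $G$ acts on $\Omega^2=\Omega\times\Omega$ by $(\alpha,\beta)^g=(\alpha^g,\beta^g)$. The $2$-closure $G^{(2),\Omega}$ is the largest subgroup of $\mathrm{Sym}(\Omega)$ leaving each orbit of $G$ on $\Omega^2$ invariant. A finite group $G$ is totally $2$-closed if $G=G^{(2),\Omega}$ for every finite faithful $G$-set $\Omega$. The group $G$ is assumed nontrivial. Generalized quaternion groups are the groups $Q_{2^n}=\langle a,b\mid a^{2^{n-1}}=1,\ b^2=a^{2^{n-2}},\ b^{-1}ab=a^{-1}\rangle$ of order $2^n$ with $n\ge 3$ (including the quaternion group of order $8$). The cyclic group of odd order is allowed to have order $1$. *)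

theory Defs
  imports "HOL-Algebra.Algebra"
begin

section \<open>Nilpotent groups\<close>

primrec lower_central_series :: "('a, 'b) monoid_scheme \<Rightarrow> nat \<Rightarrow> 'a set" where
  "lower_central_series G 0 = carrier G"
| "lower_central_series G (Suc k) =
     generate G (\<Union>x \<in> lower_central_series G k. \<Union>y \<in> carrier G.
       {x \<otimes>\<^bsub>G\<^esub> y \<otimes>\<^bsub>G\<^esub> inv\<^bsub>G\<^esub> x \<otimes>\<^bsub>G\<^esub> inv\<^bsub>G\<^esub> y})"

definition nilpotent_group :: "('a, 'b) monoid_scheme \<Rightarrow> bool" where
  "nilpotent_group G \<longleftrightarrow> group G \<and> (\<exists>k. lower_central_series G k = {\<one>\<^bsub>G\<^esub>})"


section \<open>The 2-closure of a group action\<close>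

text \<open>
  The library uses left actions (\<open>BijGroup\<close> composes functions from right to left). Passing from
  a right action to the left action \<open>g x = x\<^sup>h\<close>, where \<open>h\<close> is the inverse of \<open>g\<close>, changes neither
  the image of the group nor its orbits.
\<close>

definition pair_action :: "'c set \<Rightarrow> ('a \<Rightarrow> 'c \<Rightarrow> 'c) \<Rightarrow> 'a \<Rightarrow> 'c \<times> 'c \<Rightarrow> 'c \<times> 'c" where
  "pair_action \<Omega> \<phi> g = (\<lambda>p \<in> \<Omega> \<times> \<Omega>. map_prod (\<phi> g) (\<phi> g) p)"

definition two_closure ::
  "('a, 'b) monoid_scheme \<Rightarrow> 'c set \<Rightarrow> ('a \<Rightarrow> 'c \<Rightarrow> 'c) \<Rightarrow> ('c \<Rightarrow> 'c) set" where
  "two_closure G \<Omega> \<phi> =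
     (GREATEST H. subgroup H (BijGroup \<Omega>) \<and>
        (\<forall>f \<in> H. \<forall>\<Delta> \<in> orbits G (\<Omega> \<times> \<Omega>) (pair_action \<Omega> \<phi>). map_prod f f ` \<Delta> = \<Delta>))"

text \<open>
  HOL cannot quantify over all types inside a definition, so \<open>\<Omega>\<close> ranges over the finite sets of
  natural numbers; every finite faithful \<open>G\<close>-set is isomorphic to one of these, and
  \<open>totally_2_closedD\<close> below shows that the property holds for finite sets of any type.
\<close>

definition totally_2_closed :: "('a, 'b) monoid_scheme \<Rightarrow> bool" where
  "totally_2_closed G \<longleftrightarrow>
     group G \<and> finite (carrier G) \<and>
     (\<forall>(\<Omega> :: nat set) \<phi>. finite \<Omega> \<and> faithful_action G \<Omega> \<phi> \<longrightarrow>
        \<phi> ` carrier G = two_closure G \<Omega> \<phi>)"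


subsection \<open>Basic facts\<close>

lemma pair_action_group_action:
  assumes "group_action G \<Omega> \<phi>"
  shows "group_action G (\<Omega> \<times> \<Omega>) (pair_action \<Omega> \<phi>)"
proof -
  interpret A: group_action G \<Omega> \<phi> by fact
  interpret G: group G
    using A.group_hom by (simp add: group_hom_def)
  have bij: "pair_action \<Omega> \<phi> g \<in> Bij (\<Omega> \<times> \<Omega>)" if "g \<in> carrier G" for g
  proof -
    have "bij_betw (map_prod (\<phi> g) (\<phi> g)) (\<Omega> \<times> \<Omega>) (\<Omega> \<times> \<Omega>)"
      using A.bij_prop0[OF that] by (intro bij_betw_map_prod) (auto simp: Bij_def)
    then show ?thesis
      by (auto simp: Bij_def pair_action_def cong: bij_betw_cong)
  qed
  have closed: "\<phi> g x \<in> \<Omega>" if "g \<in> carrier G" "x \<in> \<Omega>" for g x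
    using A.element_image that by blast
  have mult: "pair_action \<Omega> \<phi> (g \<otimes>\<^bsub>G\<^esub> h) = compose (\<Omega> \<times> \<Omega>) (pair_action \<Omega> \<phi> g) (pair_action \<Omega> \<phi> h)"
    if "g \<in> carrier G" "h \<in> carrier G" for g h
  proof
    fix p
    show "pair_action \<Omega> \<phi> (g \<otimes>\<^bsub>G\<^esub> h) p = compose (\<Omega> \<times> \<Omega>) (pair_action \<Omega> \<phi> g) (pair_action \<Omega> \<phi> h) p"
      using that by (cases p) (simp add: pair_action_def compose_def A.composition_rule closed)
  qed
  have "pair_action \<Omega> \<phi> \<in> hom G (BijGroup (\<Omega> \<times> \<Omega>))"
    unfolding hom_def using bij mult by (simp add: BijGroup_def)
  then show ?thesis
    by (simp add: group_action_def group_hom_def group_hom_axioms_def group_BijGroup G.is_group)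
qed

lemma two_closure_eq:
  fixes \<Omega> :: "'c set"
  assumes "group_action G \<Omega> \<phi>"
  shows "two_closure G \<Omega> \<phi> =
     {f \<in> carrier (BijGroup \<Omega>).
        \<forall>\<Delta> \<in> orbits G (\<Omega> \<times> \<Omega>) (pair_action \<Omega> \<phi>). map_prod f f ` \<Delta> = \<Delta>}"
    (is "_ = ?K")
proof -
  let ?B = "BijGroup \<Omega>"
  let ?O = "orbits G (\<Omega> \<times> \<Omega>) (pair_action \<Omega> \<phi>)"
  let ?Q = "\<lambda>H. subgroup H ?B \<and> (\<forall>f \<in> H. \<forall>\<Delta> \<in> ?O. map_prod f f ` \<Delta> = \<Delta>)"
  interpret B: group ?B by (rule group_BijGroup)
  interpret P: group_action G "\<Omega> \<times> \<Omega>" "pair_action \<Omega> \<phi>"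
    using assms by (rule pair_action_group_action)
  have sub: "\<Delta> \<subseteq> \<Omega> \<times> \<Omega>" if "\<Delta> \<in> ?O" for \<Delta>
    using P.orbits_coverture that by blast
  have comp: "map_prod (f \<otimes>\<^bsub>?B\<^esub> h) (f \<otimes>\<^bsub>?B\<^esub> h) ` \<Delta> = map_prod f f ` (map_prod h h ` \<Delta>)"
    if "f \<in> carrier ?B" "h \<in> carrier ?B" "\<Delta> \<in> ?O" for f h \<Delta>
  proof -
    have "map_prod (f \<otimes>\<^bsub>?B\<^esub> h) (f \<otimes>\<^bsub>?B\<^esub> h) p = map_prod f f (map_prod h h p)" if "p \<in> \<Delta>" for p
      using that sub[OF \<open>\<Delta> \<in> ?O\<close>] \<open>f \<in> carrier ?B\<close> \<open>h \<in> carrier ?B\<close>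
      by (auto simp: BijGroup_def compose_def)
    then show ?thesis
      by (simp add: image_image cong: image_cong)
  qed
  have one: "map_prod \<one>\<^bsub>?B\<^esub> \<one>\<^bsub>?B\<^esub> ` \<Delta> = \<Delta>" if "\<Delta> \<in> ?O" for \<Delta>
  proof -
    have "map_prod \<one>\<^bsub>?B\<^esub> \<one>\<^bsub>?B\<^esub> p = p" if "p \<in> \<Delta>" for p
      using that sub[OF \<open>\<Delta> \<in> ?O\<close>] by (auto simp: BijGroup_def)
    then show ?thesis
      by (simp cong: image_cong)
  qed
  have "subgroup ?K ?B"
  proof (rule B.subgroupI)
    show "?K \<subseteq> carrier ?B" by blast
    show "?K \<noteq> {}" using one by blast
  next
    fix f assume f: "f \<in> ?K"
    have "map_prod (inv\<^bsub>?B\<^esub> f) (inv\<^bsub>?B\<^esub> f) ` \<Delta> = \<Delta>" if "\<Delta> \<in> ?O" for \<Delta>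
    proof -
      have "map_prod (inv\<^bsub>?B\<^esub> f) (inv\<^bsub>?B\<^esub> f) ` \<Delta>
          = map_prod (inv\<^bsub>?B\<^esub> f) (inv\<^bsub>?B\<^esub> f) ` (map_prod f f ` \<Delta>)"
        using f that by simp
      also have "\<dots> = map_prod (inv\<^bsub>?B\<^esub> f \<otimes>\<^bsub>?B\<^esub> f) (inv\<^bsub>?B\<^esub> f \<otimes>\<^bsub>?B\<^esub> f) ` \<Delta>"
        using f that by (intro comp[symmetric]) auto
      finally show ?thesis
        using f that one by simp
    qed
    then show "inv\<^bsub>?B\<^esub> f \<in> ?K" using f by simp
  next
    fix f h assume f: "f \<in> ?K" and h: "h \<in> ?K"
    have "map_prod (f \<otimes>\<^bsub>?B\<^esub> h) (f \<otimes>\<^bsub>?B\<^esub> h) ` \<Delta> = \<Delta>" if "\<Delta> \<in> ?O" for \<Delta>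
      using f h that comp[of f h \<Delta>] by auto
    then show "f \<otimes>\<^bsub>?B\<^esub> h \<in> ?K" using f h by simp
  qed
  then have "?Q ?K" by blast
  moreover have "H \<subseteq> ?K" if "?Q H" for H
    using that subgroup.subset[of H ?B] by blast
  ultimately show ?thesis
    unfolding two_closure_def by (rule Greatest_equality)
qed

lemma totally_2_closedD:
  fixes \<Omega> :: "'c set"
  assumes "totally_2_closed G" "finite \<Omega>" "faithful_action G \<Omega> \<phi>"
  shows "\<phi> ` carrier G = two_closure G \<Omega> \<phi>"
proof -
  interpret A: faithful_action G \<Omega> \<phi> by fact
  interpret G: group G using A.group_hom by (simp add: group_hom_def)
  obtain e :: "'c \<Rightarrow> nat" where e: "inj_on e \<Omega>"
    using finite_imp_inj_to_nat_seg[OF \<open>finite \<Omega>\<close>] by blast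
  let ?N = "e ` \<Omega>"
  let ?i = "inv_into \<Omega> e"
  define T where "T f = (\<lambda>n \<in> ?N. e (f (?i n)))" for f :: "'c \<Rightarrow> 'c"
  have ie [simp]: "?i (e x) = x" if "x \<in> \<Omega>" for x
    using e that by simp
  have Bij_map: "f x \<in> \<Omega>" if "f \<in> Bij \<Omega>" "x \<in> \<Omega>" for f x
    using that Bij_imp_funcset by blast
  have T_e [simp]: "T f (e x) = e (f x)" if "x \<in> \<Omega>" for f x
    using that by (simp add: T_def)
  have T_Bij: "T f \<in> Bij ?N" if f: "f \<in> Bij \<Omega>" for f
  proof -
    have "bij_betw e \<Omega> ?N" using e by (simp add: bij_betw_def)
    moreover have "bij_betw f \<Omega> \<Omega>" using f by (simp add: Bij_def)
    ultimately have "bij_betw (e \<circ> (f \<circ> ?i)) ?N ?N"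
      by (meson bij_betw_inv_into bij_betw_trans)
    then have "bij_betw (T f) ?N ?N"
      by (simp add: T_def o_def cong: bij_betw_cong)
    then show ?thesis by (simp add: Bij_def T_def)
  qed
  have T_comp: "T (compose \<Omega> f h) = compose ?N (T f) (T h)" if "h \<in> Bij \<Omega>" for f h
    using that by (auto simp: fun_eq_iff T_def compose_def Bij_map)
  have T_inj: "f = h" if "f \<in> Bij \<Omega>" "h \<in> Bij \<Omega>" "T f = T h" for f h
  proof (rule extensionalityI)
    show "f \<in> extensional \<Omega>" "h \<in> extensional \<Omega>"
      using that by (auto simp: Bij_def)
    fix x assume x: "x \<in> \<Omega>"
    then have "e (f x) = e (h x)" using that(3) T_e by metis
    then show "f x = h x" using e x that Bij_map by (meson inj_onD)
  qed
  let ?\<psi> = "\<lambda>g. T (\<phi> g)"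
  have \<phi>: "\<phi> g \<in> Bij \<Omega>" if "g \<in> carrier G" for g
    using that by (rule A.bij_prop0)
  have \<phi>_mult: "\<phi> (g \<otimes>\<^bsub>G\<^esub> h) = compose \<Omega> (\<phi> g) (\<phi> h)" if "g \<in> carrier G" "h \<in> carrier G" for g h
    using group_hom.hom_mult[OF A.group_hom that] \<phi> that by (simp add: BijGroup_def)
  have "?\<psi> \<in> hom G (BijGroup ?N)"
    unfolding hom_def using \<phi> \<phi>_mult T_Bij T_comp by (auto simp: BijGroup_def)
  then have act': "group_action G ?N ?\<psi>"
    by (simp add: group_action_def group_hom_def group_hom_axioms_def group_BijGroup G.is_group)
  have "inj_on ?\<psi> (carrier G)"
    using A.faithful \<phi> T_inj by (metis (no_types, lifting) inj_on_def)
  with act' have "faithful_action G ?N ?\<psi>"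
    by (simp add: faithful_action_def faithful_action_axioms_def)
  then have closed: "?\<psi> ` carrier G = two_closure G ?N ?\<psi>"
    using assms unfolding totally_2_closed_def by blast
  have orb: "orbit G (pair_action ?N ?\<psi>) (e x, e y)
      = map_prod e e ` orbit G (pair_action \<Omega> \<phi>) (x, y)" if "x \<in> \<Omega>" "y \<in> \<Omega>" for x y
    using that by (auto simp: orbit_def pair_action_def image_iff)
  have orb_sub: "orbit G (pair_action \<Omega> \<phi>) (x, y) \<subseteq> \<Omega> \<times> \<Omega>" if "x \<in> \<Omega>" "y \<in> \<Omega>" for x y
    using that \<phi> Bij_map by (auto simp: orbit_def pair_action_def)
  have key: "T f \<in> two_closure G ?N ?\<psi>" if f: "f \<in> two_closure G \<Omega> \<phi>" for f
  proof -
    have fB: "f \<in> Bij \<Omega>"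
      and inv: "\<And>\<Delta>. \<Delta> \<in> orbits G (\<Omega> \<times> \<Omega>) (pair_action \<Omega> \<phi>) \<Longrightarrow> map_prod f f ` \<Delta> = \<Delta>"
      using f by (auto simp: two_closure_eq[OF A.group_action_axioms] BijGroup_def)
    have "map_prod (T f) (T f) ` \<Delta> = \<Delta>"
      if "\<Delta> \<in> orbits G (?N \<times> ?N) (pair_action ?N ?\<psi>)" for \<Delta>
    proof -
      obtain x y where xy: "x \<in> \<Omega>" "y \<in> \<Omega>"
        and \<Delta>: "\<Delta> = orbit G (pair_action ?N ?\<psi>) (e x, e y)"
        using \<open>\<Delta> \<in> _\<close> by (auto simp: orbits_def)
      let ?\<Gamma> = "orbit G (pair_action \<Omega> \<phi>) (x, y)"
      have "map_prod (T f) (T f) ` \<Delta> = (\<lambda>p. map_prod (T f) (T f) (map_prod e e p)) ` ?\<Gamma>"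
        using xy \<Delta> orb by (simp add: image_image)
      also have "\<dots> = (\<lambda>p. map_prod e e (map_prod f f p)) ` ?\<Gamma>"
        using orb_sub[OF xy] by (intro image_cong) auto
      also have "\<dots> = map_prod e e ` (map_prod f f ` ?\<Gamma>)"
        by (simp add: image_image)
      also have "map_prod f f ` ?\<Gamma> = ?\<Gamma>"
        using xy by (intro inv) (auto simp: orbits_def)
      also have "map_prod e e ` ?\<Gamma> = \<Delta>"
        using xy \<Delta> orb by simp
      finally show ?thesis .
    qed
    then show ?thesis
      using T_Bij[OF fB] by (simp add: two_closure_eq[OF act'] BijGroup_def)
  qed
  show ?thesis
  proof
    show "two_closure G \<Omega> \<phi> \<subseteq> \<phi> ` carrier G"
    proof
      fix f assume f: "f \<in> two_closure G \<Omega> \<phi>"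
      then obtain g where g: "g \<in> carrier G" "T f = T (\<phi> g)"
        using key closed by blast
      moreover have "f \<in> Bij \<Omega>"
        using f by (simp add: two_closure_eq[OF A.group_action_axioms] BijGroup_def)
      ultimately show "f \<in> \<phi> ` carrier G"
        using T_inj \<phi> by blast
    qed
    have "map_prod (\<phi> g) (\<phi> g) ` \<Delta> = \<Delta>"
      if g: "g \<in> carrier G" and \<Delta>: "\<Delta> \<in> orbits G (\<Omega> \<times> \<Omega>) (pair_action \<Omega> \<phi>)" for g \<Delta>
    proof -
      interpret P: group_action G "\<Omega> \<times> \<Omega>" "pair_action \<Omega> \<phi>"
        by (rule pair_action_group_action) (rule A.group_action_axioms)
      obtain p where p: "p \<in> \<Omega> \<times> \<Omega>" "\<Delta> = orbit G (pair_action \<Omega> \<phi>) p"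
        using \<Delta> by (auto simp: orbits_def)
      have el: "pair_action \<Omega> \<phi> h p \<in> \<Omega> \<times> \<Omega>" if "h \<in> carrier G" for h
        using P.element_image p that by blast
      have step: "map_prod (\<phi> g) (\<phi> g) (pair_action \<Omega> \<phi> h p) = pair_action \<Omega> \<phi> (g \<otimes>\<^bsub>G\<^esub> h) p"
        if "h \<in> carrier G" for h
        using P.composition_rule[OF p(1) g that] el[OF that]
        by (simp add: pair_action_def[of \<Omega> \<phi> g])
      let ?p = "\<lambda>h. pair_action \<Omega> \<phi> h p"
      have \<Delta>_eq: "\<Delta> = ?p ` carrier G"
        unfolding p(2) orbit_def by (rule Setcompr_eq_image)
      have "map_prod (\<phi> g) (\<phi> g) ` \<Delta> = (\<lambda>h. map_prod (\<phi> g) (\<phi> g) (?p h)) ` carrier G"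
        unfolding \<Delta>_eq by (rule image_image)
      also have "\<dots> = (\<lambda>h. ?p (g \<otimes>\<^bsub>G\<^esub> h)) ` carrier G"
        by (rule image_cong[OF HOL.refl]) (rule step)
      also have "\<dots> = ?p ` ((\<lambda>h. g \<otimes>\<^bsub>G\<^esub> h) ` carrier G)"
        by (rule image_image[symmetric])
      also have "\<dots> = \<Delta>"
        unfolding \<Delta>_eq using G.surj_const_mult[OF g] by (rule arg_cong)
      finally show ?thesis .
    qed
    then show "\<phi> ` carrier G \<subseteq> two_closure G \<Omega> \<phi>"
      using \<phi> by (auto simp: two_closure_eq[OF A.group_action_axioms] BijGroup_def)
  qed
qed


section \<open>Generalized quaternion groups\<close>

text \<open>
  A word is a list of letters; \<open>(x, True)\<close> stands for the generator \<open>x\<close> and \<open>(x, False)\<close> for its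
  inverse. A relation \<open>u = v\<close> is given as the pair \<open>(u, v)\<close>.
\<close>

type_synonym 'g word = "('g \<times> bool) list"

inductive word_equiv :: "('g word \<times> 'g word) set \<Rightarrow> 'g word \<Rightarrow> 'g word \<Rightarrow> bool"
  for R where
  refl: "word_equiv R u u"
| sym: "word_equiv R u v \<Longrightarrow> word_equiv R v u"
| trans: "word_equiv R u v \<Longrightarrow> word_equiv R v w \<Longrightarrow> word_equiv R u w"
| cancel: "word_equiv R (u @ [(x, s), (x, \<not> s)] @ v) (u @ v)"
| rel: "(l, r) \<in> R \<Longrightarrow> word_equiv R (u @ l @ v) (u @ r @ v)"

definition word_class :: "('g word \<times> 'g word) set \<Rightarrow> 'g word \<Rightarrow> 'g word set" where
  "word_class R u = {v. word_equiv R u v}"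

definition presented_group :: "('g word \<times> 'g word) set \<Rightarrow> 'g word set monoid" where
  "presented_group R =
     \<lparr>carrier = range (word_class R),
      monoid.mult = (\<lambda>A B. \<Union>u \<in> A. \<Union>v \<in> B. word_class R (u @ v)),
      one = word_class R []\<rparr>"

datatype quaternion_gen = gen_a | gen_b

text \<open>The group \<open>Q\<close> of order \<open>2 ^ n\<close>; only \<open>n \<ge> 3\<close> is meant.\<close>

definition generalized_quaternion :: "nat \<Rightarrow> quaternion_gen word set monoid" where
  "generalized_quaternion n =
     (let a = (gen_a, True); b = (gen_b, True); a' = (gen_a, False); b' = (gen_b, False)
      in presented_group
           {(replicate (2 ^ (n - 1)) a, []),
            ([b, b], replicate (2 ^ (n - 2)) a),
            ([b', a, b], [a'])})"


subsection \<open>Basic facts\<close>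

lemma word_equiv_context:
  "word_equiv R u v \<Longrightarrow> word_equiv R (p @ u @ q) (p @ v @ q)"
proof (induction rule: word_equiv.induct)
  case (cancel u x s v)
  show ?case using word_equiv.cancel[of R "p @ u" x s "v @ q"] by simp
next
  case (rel l r u v)
  then show ?case using word_equiv.rel[of l r R "p @ u" "v @ q"] by simp
qed (blast intro: word_equiv.intros)+

lemma word_class_eq_iff: "word_class R u = word_class R v \<longleftrightarrow> word_equiv R u v"
  by (auto simp: word_class_def intro: word_equiv.intros)

lemma presented_group_mult:
  "word_class R u \<otimes>\<^bsub>presented_group R\<^esub> word_class R v = word_class R (u @ v)"
proof -
  have "word_class R (u' @ v') = word_class R (u @ v)"
    if "u' \<in> word_class R u" "v' \<in> word_class R v" for u' v'
  proof -
    have "word_equiv R (u @ v) (u' @ v)" "word_equiv R (u' @ v) (u' @ v')"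
      using that word_equiv_context[of R u u' "[]" v] word_equiv_context[of R v v' u' "[]"]
      by (auto simp: word_class_def)
    then show ?thesis
      unfolding word_class_eq_iff by (blast intro: word_equiv.intros)
  qed
  then have "(\<Union>u' \<in> word_class R u. \<Union>v' \<in> word_class R v. word_class R (u' @ v'))
      = (\<Union>u' \<in> word_class R u. \<Union>v' \<in> word_class R v. word_class R (u @ v))"
    by simp
  also have "\<dots> = word_class R (u @ v)"
  proof -
    have "u \<in> word_class R u" "v \<in> word_class R v"
      by (simp_all add: word_class_def word_equiv.refl)
    then show ?thesis by auto
  qed
  finally show ?thesis
    by (simp add: presented_group_def)
qed

lemma group_presented_group: "group (presented_group R)"
proof (rule groupI)
  let ?P = "presented_group R"
  have carrier: "carrier ?P = range (word_class R)" and one: "\<one>\<^bsub>?P\<^esub> = word_class R []"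
    by (simp_all add: presented_group_def)
  have inv: "\<exists>v. word_equiv R (v @ u) []" for u
  proof (induction u)
    case Nil
    show ?case by (auto intro: word_equiv.refl)
  next
    case (Cons c u)
    obtain v where v: "word_equiv R (v @ u) []" using Cons by blast
    obtain x s where c: "c = (x, s)" by fastforce
    have "word_equiv R ((v @ [(x, \<not> s)]) @ c # u) (v @ u)"
      using word_equiv.cancel[of R v x "\<not> s" u] by (simp add: c)
    then show ?case using v word_equiv.trans by blast
  qed
  show "\<exists>y \<in> carrier ?P. y \<otimes>\<^bsub>?P\<^esub> x = \<one>\<^bsub>?P\<^esub>" if "x \<in> carrier ?P" for x
    using that inv by (auto simp: carrier one presented_group_mult word_class_eq_iff)
  show "x \<otimes>\<^bsub>?P\<^esub> y \<in> carrier ?P" if "x \<in> carrier ?P" "y \<in> carrier ?P" for x y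
    using that by (auto simp: carrier presented_group_mult)
  show "x \<otimes>\<^bsub>?P\<^esub> y \<otimes>\<^bsub>?P\<^esub> z = x \<otimes>\<^bsub>?P\<^esub> (y \<otimes>\<^bsub>?P\<^esub> z)"
    if "x \<in> carrier ?P" "y \<in> carrier ?P" "z \<in> carrier ?P" for x y z
    using that by (auto simp: carrier presented_group_mult)
  show "\<one>\<^bsub>?P\<^esub> \<otimes>\<^bsub>?P\<^esub> x = x" if "x \<in> carrier ?P" for x
    using that by (auto simp: carrier one presented_group_mult)
qed (simp add: presented_group_def)

end

theory Submission
  imports Defs "HOL-Number_Theory.Cong"
begin

text \<open>
  Let \<open>G\<close> act on a disjoint union of coset spaces \<open>G/H\<^sub>i\<close>. A permutation acting as some \<open>h\<^sub>i \<in> G\<close>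
  on each \<open>G/H\<^sub>i\<close> often lies in the 2-closure without lying in \<open>G\<close>. If \<open>H\<close> is core-free,
  \<open>h \<in> H\<close> lies in a term of the lower central series and not in the next one \<open>M\<close>, then acting
  trivially on \<open>G/H\<close> and as \<open>h\<close> on \<open>G/M\<close> is such a permutation; hence subgroups of prime order are
  normal. For two subgroups \<open>\<langle>x\<rangle> \<noteq> \<langle>y\<rangle>\<close> of order \<open>p\<close>, acting as \<open>1, 1, x\<close> on the cosets of
  \<open>\<langle>x\<rangle>, \<langle>y\<rangle>, \<langle>x y\<rangle>\<close> is another one; hence \<open>G\<close> has at most one subgroup of order \<open>p\<close>.

  Now let \<open>\<langle>a\<rangle>\<close> be a cyclic normal subgroup of maximal order; uniqueness and nilpotency make it
  self-centralizing. An element \<open>x\<close> outside \<open>\<langle>a\<rangle>\<close> with \<open>x\<^sup>p \<in> \<langle>a\<rangle>\<close> acts by \<open>a \<mapsto> a\<^sup>k\<close> with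
  \<open>k\<close> congruent to 1 modulo every prime dividing the order of \<open>a\<close>. As no element of \<open>\<langle>a\<rangle> x\<close> has
  order \<open>p\<close>, this forces \<open>p = 2\<close>, and \<open>x\<close> inverts the 2-part of \<open>\<langle>a\<rangle>\<close>, which has order at least
  4, and centralizes the odd part. So \<open>\<langle>a\<rangle>\<close> has index at most 2, and if the index is 2, then a
  suitable \<open>a\<^sup>t x\<close> and the 2-part of \<open>\<langle>a\<rangle>\<close> generate a generalized quaternion group.
\<close>


section \<open>Arithmetic\<close>

lemma geometric_sum_int:
  fixes k :: int
  shows "(k - 1) * (\<Sum>j<p. k ^ j) = k ^ p - 1"
  by (induction p) (auto simp: algebra_simps)

lemma geometric_sum_cong:
  fixes k :: int
  assumes "[k = 1] (mod q)"
  shows "[(\<Sum>j<p. k ^ j) = int p] (mod q)"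
proof -
  have "[(\<Sum>j<p. k ^ j) = (\<Sum>j<p. 1 ^ j)] (mod q)"
    by (intro cong_sum cong_pow assms)
  then show ?thesis by simp
qed

lemma coprime_intI_prime:
  fixes a b :: int
  assumes "b \<noteq> 0" and "\<And>q. Factorial_Ring.prime q \<Longrightarrow> q dvd a \<Longrightarrow> q dvd b \<Longrightarrow> False"
  shows "coprime a b"
proof (rule ccontr)
  assume "\<not> coprime a b"
  then have "\<not> is_unit (gcd a b)" by (simp add: coprime_iff_gcd_eq_1)
  moreover have "gcd a b \<noteq> 0" using assms(1) by simp
  ultimately obtain q where "Factorial_Ring.prime q" "q dvd gcd a b" using prime_divisor_exists by blast
  then show False using assms(2)[of q] by auto
qed

text \<open>Write \<open>k = 1 + p t\<close>. Modulo \<open>p^2\<close> only the constant and linear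
  terms of the powers survive, and the linear ones add up to \<open>p t\<close> times
  \<open>p (p - 1) / 2\<close>. For odd \<open>p\<close> the latter is itself divisible by
  \<open>p\<close>, so only the constant terms, \<open>p\<close> in all, remain.\<close>

lemma geometric_sum_prime_square:
  fixes k :: int
  assumes p: "Factorial_Ring.prime p" "odd p" and k: "[k = 1] (mod int p)"
  shows "[(\<Sum>j<p. k ^ j) = int p] (mod (int p)^2)"
proof -
  obtain t where t: "k = 1 + int p * t"
    using k by (metis add.commute cong_iff_lin cong_sym)
  have pow: "[(1 + int p * t) ^ j = 1 + int j * (int p * t)] (mod (int p)^2)" for j
  proof (induction j)
    case (Suc j)
    have "[(1 + int p * t) ^ Suc j = (1 + int p * t) * (1 + int j * (int p * t))] (mod (int p)^2)"
      using Suc by (auto intro: cong_mult)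
    moreover have "(1 + int p * t) * (1 + int j * (int p * t))
        = 1 + int (Suc j) * (int p * t) + (int p)^2 * (int j * t^2)"
      by (simp add: algebra_simps power2_eq_square)
    ultimately show ?case by (metis cong_add_lcancel_0 cong_mult_self_left cong_trans)
  qed simp
  have "[(\<Sum>j<p. k ^ j) = (\<Sum>j<p. 1 + int j * (int p * t))] (mod (int p)^2)"
    unfolding t by (intro cong_sum pow)
  moreover have "(\<Sum>j<p. 1 + int j * (int p * t)) = int p + (\<Sum>j<p. int j) * (int p * t)"
    by (simp add: sum.distrib sum_distrib_right)
  moreover have "int p dvd (\<Sum>j<p. int j)"
  proof -
    have "2 * (\<Sum>j<p. int j) = int p * (int p - 1)"
      by (induction p) (auto simp: algebra_simps)
    then have "int p dvd 2 * (\<Sum>j<p. int j)" by simp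
    moreover have "coprime (int p) 2" using p(2) by simp
    ultimately show ?thesis using coprime_dvd_mult_right_iff by blast
  qed
  then have "[int p + (\<Sum>j<p. int j) * (int p * t) = int p] (mod (int p)^2)"
    by (auto simp: cong_iff_dvd_diff power2_eq_square elim!: dvdE)
  ultimately show ?thesis by (metis cong_trans)
qed

lemma linear_cong_solvable:
  fixes S s m :: int
  assumes "gcd S m dvd s"
  shows "\<exists>t. m dvd s + t * S"
proof -
  obtain x y where xy: "x * S + y * m = gcd S m" using bezout_int by blast
  obtain c where c: "s = gcd S m * c" using assms by blast
  have "s + (- c * x) * S = m * (c * y)"
    unfolding c using xy by (simp add: xy[symmetric] algebra_simps)
  then show ?thesis by (metis dvd_triv_left)
qed

text \<open>Take for \<open>t\<close> the product of the prime divisors of \<open>m\<close> that do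
  not divide \<open>s\<close>. Then every prime divisor of \<open>m\<close> divides exactly one of
  \<open>s\<close> and \<open>t * d\<close>, hence not their sum.\<close>

lemma coprime_shift_exists:
  fixes s d m :: int
  assumes "m \<noteq> 0" "\<And>q. Factorial_Ring.prime q \<Longrightarrow> q dvd m \<Longrightarrow> q dvd d \<Longrightarrow> q dvd s \<Longrightarrow> False"
  shows "\<exists>t. coprime (s + t * d) m"
proof -
  define t where "t = (\<Prod>q \<in> {q \<in> prime_factors m. \<not> q dvd s}. q)"
  have "coprime (s + t * d) m"
  proof (rule coprime_intI_prime[OF assms(1)])
    fix q :: int assume q: "Factorial_Ring.prime q" "q dvd s + t * d" "q dvd m"
    have qm: "q \<in> prime_factors m" using q assms(1) by (simp add: prime_factors_dvd)
    show False
    proof (cases "q dvd s")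
      case True
      then have "q dvd t * d" using q(2) by (simp add: dvd_add_right_iff)
      then have "q dvd t" using assms(2) q True prime_dvd_mult_iff by blast
      then obtain r where r: "r \<in> prime_factors m" "\<not> r dvd s" "q dvd r"
        unfolding t_def using q(1) by (subst (asm) prime_dvd_prod_iff) auto
      then have "q = r" using q(1) primes_dvd_imp_eq by blast
      then show False using True r by simp
    next
      case False
      then have "q dvd t" unfolding t_def using qm by (intro dvd_prodI) auto
      then show False using False q(2) by (simp add: dvd_add_left_iff)
    qed
  qed
  then show ?thesis by blast
qed

text \<open>
  Here \<open>x\<close> acts on a cyclic group \<open>\<langle>a\<rangle>\<close> of order \<open>m\<close> by \<open>a \<mapsto> a\<^sup>k\<close>, and \<open>x\<^sup>p = a\<^sup>s\<close>. Then the
  \<open>p\<close>-th power of \<open>a\<^sup>t x\<close> has exponent \<open>s + t S\<close>, so the last hypothesis says that no element of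
  the coset \<open>\<langle>a\<rangle> x\<close> has order dividing \<open>p\<close>.
\<close>

lemma automorphism_arithmetic:
  fixes k s m :: int and p :: nat
  defines "S \<equiv> (\<Sum>j<p. k ^ j)"
  assumes p: "Factorial_Ring.prime p" and m: "m > 0"
    and rad: "\<And>q. Factorial_Ring.prime q \<Longrightarrow> q dvd m \<Longrightarrow> [k = 1] (mod q)"
    and kp: "[k ^ p = 1] (mod m)" and ks: "[k * s = s] (mod m)" and k1: "\<not> [k = 1] (mod m)"
    and nosol: "\<And>t. int p dvd m \<Longrightarrow> \<not> m dvd s + t * S"
  shows "p = 2 \<and> (\<forall>e m'. m = 2 ^ e * m' \<longrightarrow> odd m' \<longrightarrow>
      e \<ge> 2 \<and> [k = -1] (mod 2 ^ e) \<and> [k = 1] (mod m') \<and> [s = 2 ^ (e - 1)] (mod 2 ^ e))"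
proof -
  let ?p = "int p"
  have pp: "Factorial_Ring.prime ?p" using p by simp
  have nu: "\<not> is_unit ?p" using pp not_prime_unit by blast
  have m0: "m \<noteq> 0" using m by simp
  define e where "e = multiplicity ?p m"
  obtain m' where m': "m = ?p ^ e * m'" "\<not> ?p dvd m'"
    using multiplicity_decompose'[of m ?p] m0 nu unfolding e_def by blast
  have m'0: "m' \<noteq> 0" using m m' by auto
  have kS: "(k - 1) * S = k ^ p - 1" unfolding S_def by (rule geometric_sum_int)
  \<comment> \<open>Modulo a prime divisor of \<open>m'\<close> all \<open>p\<close> summands of
    \<open>S\<close> are 1, so a common prime divisor would be \<open>p\<close>, which does not
    divide \<open>m'\<close>.\<close>
  have cop: "coprime S m'"
  proof (rule coprime_intI_prime[OF m'0])
    fix q assume q: "Factorial_Ring.prime q" "q dvd S" "q dvd m'"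
    then have "[S = ?p] (mod q)" unfolding S_def
      using rad[of q] m' by (intro geometric_sum_cong) auto
    then have "q dvd ?p" using q(2) cong_dvd_iff by blast
    then have "q = ?p" using primes_dvd_imp_eq q(1) pp by blast
    then show False using q(3) m'(2) by simp
  qed
  have km': "[k = 1] (mod m')"
  proof -
    have "m' dvd (k - 1) * S" unfolding kS
      using kp m'(1) by (simp add: cong_iff_dvd_diff dvd_mult_right)
    then show ?thesis using cop by (simp add: cong_iff_dvd_diff coprime_dvd_mult_left_iff coprime_commute)
  qed
  have gcd_eq: "gcd S m = gcd S (?p ^ e)"
    unfolding m'(1) using cop by (simp add: gcd_mult_right_right_cancel coprime_commute)
  have copm: "coprime (?p ^ e) m'"
    using m'(2) pp by (simp add: prime_imp_coprime)
  have kpe: "\<not> ?p ^ e dvd k - 1"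
    using k1 km' copm m'(1) by (auto simp: cong_iff_dvd_diff intro: divides_mult)
  have e0: "e > 0" using kpe by (cases e) auto
  have pm: "?p dvd m" using m'(1) e0 by auto
  \<comment> \<open>The congruence \<open>s + t S = 0\<close> modulo \<open>m\<close> has no
    solution by assumption, and since \<open>S\<close> is prime to \<open>m'\<close>, the gcd that
    governs it only sees the \<open>p\<close>-part of \<open>m\<close>.\<close>
  have no: "\<not> gcd S (?p ^ e) dvd s"
    using nosol[OF pm] linear_cong_solvable[of S m s] unfolding gcd_eq by blast
  define f where "f = multiplicity ?p (k - 1)"
  have k10: "k - 1 \<noteq> 0" using kpe by auto
  obtain r where r: "k - 1 = ?p ^ f * r" "\<not> ?p dvd r"
    using multiplicity_decompose'[of "k - 1" ?p] k10 nu unfolding f_def by blast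
  have "?p dvd k - 1" using rad[OF pp pm] by (simp add: cong_iff_dvd_diff)
  then have f1: "f \<ge> 1" using r by (cases f) auto
  have fe: "f < e"
    using kpe r(1) by (metis dvd_mult2 le_imp_power_dvd not_le)
  have cancel: "?p ^ (e - f) dvd z" if "?p ^ e dvd (k - 1) * z" for z
  proof -
    have "?p ^ f * ?p ^ (e - f) dvd ?p ^ f * (r * z)"
      using that fe r(1) by (simp add: power_add[symmetric] mult.assoc)
    then have "?p ^ (e - f) dvd r * z" using pp by (simp add: dvd_mult_cancel_left)
    moreover have "coprime (?p ^ (e - f)) r" using r(2) pp by (simp add: prime_imp_coprime)
    ultimately show ?thesis using coprime_dvd_mult_right_iff by blast
  qed
  have pS: "?p ^ (e - f) dvd S"
    by (rule cancel) (use kp m'(1) in \<open>auto simp: kS cong_iff_dvd_diff dvd_mult_left\<close>)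
  have ps: "?p ^ (e - f) dvd s"
  proof (rule cancel)
    have "m dvd (k - 1) * s" using ks by (simp add: cong_iff_dvd_diff algebra_simps)
    then show "?p ^ e dvd (k - 1) * s" using m'(1) dvd_mult_left by blast
  qed
  \<comment> \<open>If \<open>S\<close> had no more than \<open>e - f\<close> factors
    \<open>p\<close>, its gcd with \<open>p ^ e\<close> would divide \<open>p ^ (e - f)\<close>,
    hence \<open>s\<close>, against \<open>no\<close>. So \<open>S\<close> must have one more factor
    \<open>p\<close>, which fails in each of the cases excluded next.\<close>
  have small: False if "\<not> ?p ^ Suc (e - f) dvd S"
  proof -
    obtain i where i: "gcd S (?p ^ e) = ?p ^ i"
      using divides_primepow[OF pp, of "gcd S (?p ^ e)" e] by auto
    then have "?p ^ i dvd S" by (metis gcd_dvd1)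
    then have "i \<le> e - f" using that by (metis not_less_eq_eq power_le_dvd)
    then have "gcd S (?p ^ e) dvd s" using ps i le_imp_power_dvd dvd_trans by metis
    then show False using no by simp
  qed
  have big: "2 \<le> Suc (e - f)" using fe by simp
  have p2: "p = 2"
  proof (rule ccontr)
    assume "p \<noteq> 2"
    then have "odd p" using p primes_dvd_imp_eq two_is_prime_nat by blast
    then have "[S = ?p] (mod ?p ^ 2)"
      unfolding S_def using geometric_sum_prime_square[OF p] rad[OF pp pm] by blast
    have "\<not> ?p ^ 2 dvd S"
    proof
      assume "?p ^ 2 dvd S"
      then have "?p * ?p dvd ?p * 1"
        using \<open>[S = ?p] (mod ?p ^ 2)\<close> by (simp add: cong_dvd_iff power2_eq_square)
      then have "?p dvd 1" using pp by (simp only: dvd_mult_cancel_left) auto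
      then show False using nu by simp
    qed
    then have "\<not> ?p ^ Suc (e - f) dvd S"
      using big power_le_dvd by blast
    then show False by (rule small)
  qed
  have S2: "S = k + 1" unfolding S_def p2 by (simp add: numeral_2_eq_2)
  \<comment> \<open>If 4 divides \<open>k - 1\<close>, then \<open>S = k + 1\<close> is 2 modulo 4,
    while \<open>small\<close> asks for a factor 4.\<close>
  have f1': "f = 1"
  proof (rule ccontr)
    assume "f \<noteq> 1"
    then have "?p ^ 2 dvd ?p ^ f" using f1 by (intro le_imp_power_dvd) simp
    then have "4 dvd k - 1" using r(1) p2 by simp
    then have "\<not> 4 dvd S" unfolding S2 by presburger
    then have "\<not> ?p ^ 2 dvd S" using p2 by simp
    then have "\<not> ?p ^ Suc (e - f) dvd S"
      using big power_le_dvd by blast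
    then show False by (rule small)
  qed
  have e2: "e \<ge> 2" using fe f1' by simp
  have "Suc (e - f) = e" using fe f1' by simp
  then have "2 ^ e dvd S" using small p2 by auto
  then have km1: "[k = -1] (mod 2 ^ e)" and g: "gcd S (?p ^ e) = 2 ^ e"
    using p2 by (auto simp: S2 cong_iff_dvd_diff gcd_proj2_iff)
  have "\<not> 2 ^ e dvd s" using no g by simp
  moreover have "2 ^ (e - 1) dvd s" using ps p2 f1' by simp
  ultimately have "[s = 2 ^ (e - 1)] (mod 2 ^ e)"
  proof -
    obtain c where c: "s = 2 ^ (e - 1) * c" using \<open>2 ^ (e - 1) dvd s\<close> by blast
    have ee: "2 ^ e = 2 ^ (e - 1) * (2::int)" using e0 by (simp add: power_eq_if)
    have "odd c" using \<open>\<not> 2 ^ e dvd s\<close> unfolding c ee by simp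
    then have "even (c - 1)" by simp
    moreover have "s - 2 ^ (e - 1) = 2 ^ (e - 1) * (c - 1)" by (simp add: c algebra_simps)
    ultimately show ?thesis by (simp add: cong_iff_dvd_diff ee)
  qed
  \<comment> \<open>The conclusion speaks of every splitting of \<open>m\<close> into a power of 2
    and an odd factor; uniqueness identifies it with the one chosen here.\<close>
  moreover have "i = e \<and> n = m'" if n: "m = 2 ^ i * n" "odd n" for i n
  proof -
    have "multiplicity 2 m = i" using n by (intro multiplicity_eqI) auto
    then have "i = e" using p2 by (simp add: e_def)
    then show ?thesis using n(1) m'(1) p2 by simp
  qed
  ultimately show ?thesis using p2 e2 km1 km' by metis
qed

section \<open>Rigidity of 2-closed actions\<close>

lemma (in group) lcos_eq_iff:
  assumes "subgroup H G" "a \<in> carrier G" "b \<in> carrier G"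
  shows "a <# H = b <# H \<longleftrightarrow> inv a \<otimes> b \<in> H"
proof
  assume "a <# H = b <# H"
  then have "b \<in> a <# H" using lcos_self[OF assms(3,1)] by simp
  then obtain h where "h \<in> H" "b = a \<otimes> h" by (auto simp: l_coset_def)
  then show "inv a \<otimes> b \<in> H"
    using assms subgroup.mem_carrier[OF assms(1)] by (simp add: m_assoc[symmetric])
next
  assume h: "inv a \<otimes> b \<in> H"
  have "b = a \<otimes> (inv a \<otimes> b)" using assms by (simp add: m_assoc[symmetric])
  then have "b \<in> a <# H" using h unfolding l_coset_def by blast
  then show "a <# H = b <# H"
    using l_repr_independence[of b a H] assms by simp
qed

text \<open>
  On the disjoint union of the coset spaces \<open>G/H\<^sub>i\<close>, the permutation acting as \<open>h\<^sub>i\<close> on \<open>G/H\<^sub>i\<close>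
  preserves the orbits on pairs iff \<open>compat\<close> holds, and then it comes from a single element of \<open>G\<close>.
\<close>

lemma (in group) coset_family_rigid:
  assumes tc: "totally_2_closed G" and I: "finite I"
    and H: "\<And>i. i \<in> I \<Longrightarrow> subgroup (H i) G"
    and h: "\<And>i. i \<in> I \<Longrightarrow> h i \<in> carrier G"
    and core: "\<And>g. g \<in> carrier G \<Longrightarrow>
      (\<And>i a. i \<in> I \<Longrightarrow> a \<in> carrier G \<Longrightarrow> inv a \<otimes> g \<otimes> a \<in> H i) \<Longrightarrow> g = \<one>"
    and compat: "\<And>i j a b. i \<in> I \<Longrightarrow> j \<in> I \<Longrightarrow> a \<in> carrier G \<Longrightarrow> b \<in> carrier G \<Longrightarrow>
      \<exists>g \<in> carrier G. inv a \<otimes> (inv (h i) \<otimes> g) \<otimes> a \<in> H i \<and> inv b \<otimes> (inv (h j) \<otimes> g) \<otimes> b \<in> H j"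
  shows "\<exists>g \<in> carrier G. \<forall>i \<in> I. \<forall>a \<in> carrier G. inv a \<otimes> (inv (h i) \<otimes> g) \<otimes> a \<in> H i"
proof -
  \<comment> \<open>The index \<open>i\<close> is kept as a tag, so that equal cosets in different
    coset spaces stay different points; \<open>F k\<close> then moves each component by its own
    \<open>k i\<close>.\<close>
  define \<Omega> where "\<Omega> = (SIGMA i:I. (\<lambda>a. a <# H i) ` carrier G)"
  define F where "F k = (\<lambda>p \<in> \<Omega>. (fst p, k (fst p) <# snd p))" for k
  define \<phi> where "\<phi> g = F (\<lambda>_. g)" for g
  have fin: "finite (carrier G)" using tc by (simp add: totally_2_closed_def)
  have fin\<Omega>: "finite \<Omega>" unfolding \<Omega>_def using I fin by blast
  have Hsub: "H i \<subseteq> carrier G" if "i \<in> I" for i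
    using H[OF that] subgroup.subset by blast
  have mem: "(i, a <# H i) \<in> \<Omega>" if "i \<in> I" "a \<in> carrier G" for i a
    using that by (auto simp: \<Omega>_def)
  have memE: "\<exists>i a. i \<in> I \<and> a \<in> carrier G \<and> p = (i, a <# H i)" if "p \<in> \<Omega>" for p
    using that by (auto simp: \<Omega>_def)
  have F: "F k (i, a <# H i) = (i, k i \<otimes> a <# H i)"
    if "i \<in> I" "a \<in> carrier G" "k i \<in> carrier G" for k i a
    using that mem[OF that(1,2)] Hsub by (simp add: F_def lcos_m_assoc)
  \<comment> \<open>Two elements agree on the coset of \<open>a\<close> iff their quotient lies in
    its stabilizer, the conjugate of \<open>H i\<close> by \<open>a\<close>; this is the form of
    \<open>core\<close> and \<open>compat\<close>.\<close>
  have same: "k \<otimes> a <# H i = l \<otimes> a <# H i \<longleftrightarrow> inv a \<otimes> (inv k \<otimes> l) \<otimes> a \<in> H i"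
    if "i \<in> I" "a \<in> carrier G" "k \<in> carrier G" "l \<in> carrier G" for i a k l
    using that by (simp add: lcos_eq_iff H inv_mult_group m_assoc)
  have Bij: "F k \<in> Bij \<Omega>" if k: "\<And>i. i \<in> I \<Longrightarrow> k i \<in> carrier G" for k
  proof -
    let ?k = "\<lambda>i. inv (k i)"
    have "bij_betw (F k) \<Omega> \<Omega>"
    proof (rule bij_betw_byWitness[where f' = "F ?k"])
      show "\<forall>p \<in> \<Omega>. F ?k (F k p) = p" "\<forall>p \<in> \<Omega>. F k (F ?k p) = p"
        using k by (auto dest!: memE simp: F m_assoc[symmetric])
      show "F k ` \<Omega> \<subseteq> \<Omega>" "F ?k ` \<Omega> \<subseteq> \<Omega>"
        using k by (auto dest!: memE simp: F intro!: mem)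
    qed
    then show ?thesis by (simp add: Bij_def F_def)
  qed
  have \<phi>Bij: "\<phi> g \<in> Bij \<Omega>" if "g \<in> carrier G" for g
    unfolding \<phi>_def using that by (rule Bij)
  have \<phi>: "\<phi> g (i, a <# H i) = (i, g \<otimes> a <# H i)"
    if "i \<in> I" "a \<in> carrier G" "g \<in> carrier G" for g i a
    unfolding \<phi>_def using that by (rule F)
  have \<phi>_mult: "\<phi> (g \<otimes> k) = compose \<Omega> (\<phi> g) (\<phi> k)" if "g \<in> carrier G" "k \<in> carrier G" for g k
  proof (rule extensionalityI)
    show "\<phi> (g \<otimes> k) \<in> extensional \<Omega>" by (simp add: \<phi>_def F_def)
    show "compose \<Omega> (\<phi> g) (\<phi> k) \<in> extensional \<Omega>" by simp
    fix p assume "p \<in> \<Omega>"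
    then show "\<phi> (g \<otimes> k) p = compose \<Omega> (\<phi> g) (\<phi> k) p"
      using that memE[of p] by (auto simp: compose_def \<phi> m_assoc)
  qed
  have "\<phi> \<in> hom G (BijGroup \<Omega>)"
    using \<phi>Bij \<phi>_mult by (simp add: hom_def BijGroup_def)
  then have act: "group_action G \<Omega> \<phi>"
    by (simp add: group_action_def group_hom_def group_hom_axioms_def group_BijGroup is_group)
  have inj: "inj_on \<phi> (carrier G)"
  proof (rule inj_onI)
    fix k l assume k: "k \<in> carrier G" and l: "l \<in> carrier G" and eq: "\<phi> k = \<phi> l"
    have "inv k \<otimes> l = \<one>"
    proof (rule core)
      fix i a assume ia: "i \<in> I" "a \<in> carrier G"
      then have "k \<otimes> a <# H i = l \<otimes> a <# H i"
        using arg_cong[OF eq, of "\<lambda>f. f (i, a <# H i)"] k l by (simp add: \<phi>)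
      then show "inv a \<otimes> (inv k \<otimes> l) \<otimes> a \<in> H i" using ia k l by (simp add: same)
    qed (use k l in simp)
    then show "k = l" using k l by (metis inv_closed inv_equality inv_inv)
  qed
  have closed: "\<phi> ` carrier G = two_closure G \<Omega> \<phi>"
    using totally_2_closedD[OF tc fin\<Omega>] act inj
    by (simp add: faithful_action_def faithful_action_axioms_def)
  have "F h \<in> two_closure G \<Omega> \<phi>"
  proof -
    have "map_prod (F h) (F h) ` \<Delta> = \<Delta>" if orb: "\<Delta> \<in> orbits G (\<Omega> \<times> \<Omega>) (pair_action \<Omega> \<phi>)" for \<Delta>
    proof -
      obtain r where "r \<in> \<Omega> \<times> \<Omega>" "\<Delta> = orbit G (pair_action \<Omega> \<phi>) r"
        using orb unfolding orbits_def by blast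
      then obtain p q where pq: "p \<in> \<Omega>" "q \<in> \<Omega>" and \<Delta>pq: "\<Delta> = orbit G (pair_action \<Omega> \<phi>) (p, q)"
        by (cases r) blast
      obtain i a where ia: "i \<in> I" "a \<in> carrier G" and p: "p = (i, a <# H i)"
        using memE[OF pq(1)] by blast
      obtain j b where jb: "j \<in> I" "b \<in> carrier G" and q: "q = (j, b <# H j)"
        using memE[OF pq(2)] by blast
      note \<Delta> = \<Delta>pq[unfolded p q]
      have \<Delta>_eq: "\<Delta> = (\<lambda>c. ((i, c \<otimes> a <# H i), (j, c \<otimes> b <# H j))) ` carrier G"
        unfolding \<Delta> orbit_def Setcompr_eq_image
        using ia jb by (intro image_cong) (auto simp: pair_action_def mem \<phi>)
      have sub: "\<Delta> \<subseteq> \<Omega> \<times> \<Omega>" using ia jb by (auto simp: \<Delta>_eq mem)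
      have "map_prod (F h) (F h) ` \<Delta> \<subseteq> \<Delta>"
      proof
        fix q assume "q \<in> map_prod (F h) (F h) ` \<Delta>"
        then obtain c where c: "c \<in> carrier G"
          and q: "q = ((i, h i \<otimes> (c \<otimes> a) <# H i), (j, h j \<otimes> (c \<otimes> b) <# H j))"
          using ia jb h by (auto simp: \<Delta>_eq F)
        \<comment> \<open>\<open>compat\<close> at the representatives \<open>c \<otimes> a\<close>
          and \<open>c \<otimes> b\<close> yields one \<open>g\<close> that agrees with
          \<open>h i\<close> and \<open>h j\<close> on the two cosets, so the image is the translate
          of the base pair by \<open>g \<otimes> c\<close>.\<close>
        obtain g where g: "g \<in> carrier G"
            "inv (c \<otimes> a) \<otimes> (inv (h i) \<otimes> g) \<otimes> (c \<otimes> a) \<in> H i"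
            "inv (c \<otimes> b) \<otimes> (inv (h j) \<otimes> g) \<otimes> (c \<otimes> b) \<in> H j"
          using compat[of i j "c \<otimes> a" "c \<otimes> b"] ia jb c by auto
        then have "q = ((i, (g \<otimes> c) \<otimes> a <# H i), (j, (g \<otimes> c) \<otimes> b <# H j))"
          using ia jb c h by (simp add: q same m_assoc)
        then show "q \<in> \<Delta>" using g c by (auto simp: \<Delta>_eq)
      qed
      moreover have "finite \<Delta>" using sub fin\<Omega> finite_subset by blast
      moreover have "inj_on (map_prod (F h) (F h)) \<Delta>"
      proof -
        have "inj_on (F h) \<Omega>" using Bij[OF h] by (auto simp: Bij_def bij_betw_def)
        then show ?thesis using map_prod_inj_on sub inj_on_subset by blast
      qed
      ultimately show ?thesis by (intro endo_inj_surj)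
    qed
    then show ?thesis using Bij[OF h] by (simp add: two_closure_eq[OF act] BijGroup_def)
  qed
  then obtain g where g: "g \<in> carrier G" "F h = \<phi> g" using closed by blast
  have "inv a \<otimes> (inv (h i) \<otimes> g) \<otimes> a \<in> H i" if ia: "i \<in> I" "a \<in> carrier G" for i a
  proof -
    have "h i \<otimes> a <# H i = g \<otimes> a <# H i"
      using arg_cong[OF g(2), of "\<lambda>f. f (i, a <# H i)"] ia g(1) h by (simp add: \<phi> F)
    then show ?thesis using ia g(1) h by (simp add: same)
  qed
  then show ?thesis using g(1) by blast
qed

section \<open>Subgroups of prime order\<close>

lemma (in group) inv_cancel_left [simp]:
  assumes "x \<in> carrier G" "y \<in> carrier G"
  shows "x \<otimes> (inv x \<otimes> y) = y" and "inv x \<otimes> (x \<otimes> y) = y"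
  using assms by (simp_all add: m_assoc[symmetric])

lemma (in group) generate_singleton_mem: "x \<in> carrier G \<Longrightarrow> x \<in> generate G {x}"
  by (simp add: generate.incl)

text \<open>Commutators are generators by definition. Normality goes by induction: each term is
  contained in the normal term before it, and the conjugate of \<open>x\<close> by \<open>g\<close>
  is \<open>x\<close> multiplied from the left by the inverse of the commutator of \<open>x\<close>
  and \<open>g\<close>.\<close>

lemma (in group) lower_central_series_normal: "lower_central_series G k \<lhd> G"
  and lower_central_series_commutator: "x \<in> lower_central_series G k \<Longrightarrow> g \<in> carrier G \<Longrightarrow>
    x \<otimes> g \<otimes> inv x \<otimes> inv g \<in> lower_central_series G (Suc k)"
proof -
  let ?L = "lower_central_series G"
  let ?C = "\<lambda>k. \<Union>x \<in> ?L k. \<Union>y \<in> carrier G. {x \<otimes> y \<otimes> inv x \<otimes> inv y}"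
  have comm: "x \<otimes> g \<otimes> inv x \<otimes> inv g \<in> ?L (Suc k)" if "x \<in> ?L k" "g \<in> carrier G" for x g k
    unfolding lower_central_series.simps(2) by (rule generate.incl) (use that in blast)
  have dec: "?L (Suc k) \<subseteq> ?L k" if n: "?L k \<lhd> G" for k
  proof -
    have sg: "subgroup (?L k) G" using n by (rule normal_imp_subgroup)
    have "x \<otimes> y \<otimes> inv x \<otimes> inv y \<in> ?L k" if "x \<in> ?L k" "y \<in> carrier G" for x y
    proof -
      have x: "x \<in> carrier G" using subgroup.mem_carrier[OF sg that(1)] .
      have "y \<otimes> inv x \<otimes> inv y \<in> ?L k"
        using n that(2) subgroup.m_inv_closed[OF sg that(1)] unfolding normal_inv_iff by blast
      then have "x \<otimes> (y \<otimes> inv x \<otimes> inv y) \<in> ?L k"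
        by (rule subgroup.m_closed[OF sg that(1)])
      then show ?thesis using x that(2) by (simp add: m_assoc)
    qed
    then have "?C k \<subseteq> ?L k" by blast
    then show ?thesis
      unfolding lower_central_series.simps(2) using sg by (rule generate_subgroup_incl)
  qed
  have normal: "?L k \<lhd> G" for k
  proof (induction k)
    case 0
    show ?case unfolding normal_inv_iff using subgroup_self by simp
  next
    case (Suc k)
    have sgk: "subgroup (?L k) G" using Suc by (rule normal_imp_subgroup)
    have "?C k \<subseteq> carrier G"
      using subgroup.mem_carrier[OF sgk] by blast
    then have sg: "subgroup (?L (Suc k)) G"
      unfolding lower_central_series.simps(2) by (rule generate_is_subgroup)
    have "g \<otimes> x \<otimes> inv g \<in> ?L (Suc k)" if x: "x \<in> ?L (Suc k)" and g: "g \<in> carrier G" for x g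
    proof -
      have xc: "x \<in> carrier G" using subgroup.mem_carrier[OF sg x] .
      have "x \<otimes> g \<otimes> inv x \<otimes> inv g \<in> ?L (Suc k)"
        using x g dec[OF Suc] comm by blast
      then have "inv (x \<otimes> g \<otimes> inv x \<otimes> inv g) \<otimes> x \<in> ?L (Suc k)"
        using x subgroup.m_closed[OF sg] subgroup.m_inv_closed[OF sg] by blast
      then show ?thesis using xc g by (simp add: inv_mult_group m_assoc)
    qed
    then show ?case using sg by (simp only: normal_inv_iff) blast
  qed
  show "?L k \<lhd> G" by (rule normal)
  show "x \<in> ?L k \<Longrightarrow> g \<in> carrier G \<Longrightarrow> x \<otimes> g \<otimes> inv x \<otimes> inv g \<in> ?L (Suc k)"
    by (rule comm)
qed

text \<open>The series starts with \<open>carrier G\<close> and reaches the trivial group, so there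
  is a first index at which its intersection with \<open>S\<close> falls inside \<open>T\<close>.
  Elements of \<open>S\<close> outside \<open>T\<close> in the layer before have their commutators
  in a layer that meets \<open>S\<close> only inside \<open>T\<close>.\<close>

lemma (in group) nilpotent_last_layer:
  assumes nil: "nilpotent_group G" and S: "S \<subseteq> carrier G" "\<one> \<in> T" "\<not> S \<subseteq> T"
  obtains k where "S \<inter> lower_central_series G (Suc k) \<subseteq> T" "\<not> S \<inter> lower_central_series G k \<subseteq> T"
proof -
  let ?P = "\<lambda>k. S \<inter> lower_central_series G k \<subseteq> T"
  obtain c where "lower_central_series G c = {\<one>}"
    using nil by (auto simp: nilpotent_group_def)
  then have "?P c" using S(2) by auto
  moreover have "\<not> ?P 0" using S by auto
  ultimately obtain k where "\<not> ?P k" "?P (Suc k)"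
    using ex_least_nat_less[of ?P c] by blast
  then show thesis using that by blast
qed

lemma (in group) prime_card_subgroup_eq:
  assumes H: "subgroup H G" "Factorial_Ring.prime (card H)" and K: "subgroup K G" "K \<subseteq> H" "x \<in> K" "x \<noteq> \<one>"
  shows "K = H"
proof -
  have fin: "finite H" using H(2) card.infinite not_prime_0 by metis
  interpret H: group "G\<lparr>carrier := H\<rparr>" using H(1) by (rule subgroup_imp_group)
  have "subgroup K (G\<lparr>carrier := H\<rparr>)" using subgroup_incl[OF K(1) H(1) K(2)] .
  from H.lagrange[OF this] have "card K dvd card H" by (simp add: order_def) (metis dvd_triv_right)
  then have "card K = 1 \<or> card K = card H" using H(2) prime_nat_iff by blast
  moreover have "card K \<noteq> 1"
  proof
    assume "card K = 1"
    then obtain y where "K = {y}" by (auto simp: card_1_singleton_iff)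
    then show False using subgroup.one_closed[OF K(1)] K(3,4) by auto
  qed
  ultimately show ?thesis using fin K(2) card_subset_eq by blast
qed

text \<open>If \<open>H\<close> is not normal, its core \<open>C\<close> is a proper subgroup of a
  group of prime order, hence trivial. So \<open>G\<close> is faithful on the cosets of
  \<open>H\<close>, and a second coset space can be added on which another element acts.\<close>

lemma (in group) prime_card_subgroup_normal:
  assumes nil: "nilpotent_group G" and tc: "totally_2_closed G"
    and H: "subgroup H G" "Factorial_Ring.prime (card H)"
  shows "H \<lhd> G"
proof (rule ccontr)
  assume not_normal: "\<not> H \<lhd> G"
  have Hc: "H \<subseteq> carrier G" using H(1) by (rule subgroup.subset)
  define C where "C = {g \<in> carrier G. \<forall>a \<in> carrier G. inv a \<otimes> g \<otimes> a \<in> H}"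
  have C: "subgroup C G"
  proof (rule subgroupI)
    show "C \<subseteq> carrier G" by (auto simp: C_def)
    have "\<one> \<in> C" using subgroup.one_closed[OF H(1)] by (simp add: C_def)
    then show "C \<noteq> {}" by blast
    fix g assume g: "g \<in> C"
    have "inv a \<otimes> inv g \<otimes> a \<in> H" if a: "a \<in> carrier G" for a
    proof -
      have "inv (inv a \<otimes> g \<otimes> a) \<in> H"
        using g a by (intro subgroup.m_inv_closed[OF H(1)]) (simp add: C_def)
      then show ?thesis using g a by (simp add: C_def inv_mult_group m_assoc)
    qed
    then show "inv g \<in> C" using g by (simp add: C_def)
    fix g' assume g': "g' \<in> C"
    have "inv a \<otimes> (g \<otimes> g') \<otimes> a \<in> H" if a: "a \<in> carrier G" for a
    proof -
      have "inv a \<otimes> g \<otimes> a \<in> H" "inv a \<otimes> g' \<otimes> a \<in> H"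
        using g g' a by (simp_all add: C_def)
      then have "(inv a \<otimes> g \<otimes> a) \<otimes> (inv a \<otimes> g' \<otimes> a) \<in> H"
        by (rule subgroup.m_closed[OF H(1)])
      then show ?thesis using g g' a by (simp add: C_def m_assoc)
    qed
    then show "g \<otimes> g' \<in> C" using g g' by (simp add: C_def)
  qed
  have CH: "C \<subseteq> H"
  proof
    fix g assume "g \<in> C"
    then have "g \<in> carrier G" "inv \<one> \<otimes> g \<otimes> \<one> \<in> H" unfolding C_def by blast+
    then show "g \<in> H" by simp
  qed
  have C1: "g = \<one>" if "g \<in> C" for g
  proof (rule ccontr)
    assume "g \<noteq> \<one>"
    then have "C = H" using prime_card_subgroup_eq[OF H C CH that] by blast
    then have conj: "inv b \<otimes> h \<otimes> b \<in> H" if "b \<in> carrier G" "h \<in> H" for b h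
      using that unfolding C_def by blast
    have "a \<otimes> h \<otimes> inv a \<in> H" if "a \<in> carrier G" "h \<in> H" for a h
      using conj[of "inv a" h] that by simp
    then show False using not_normal H(1) unfolding normal_inv_iff by blast
  qed
  have "\<not> H \<subseteq> {\<one>}"
  proof
    assume "H \<subseteq> {\<one>}"
    then have "card H \<le> 1" using card_mono[of "{\<one>}" H] by simp
    then show False using prime_gt_1_nat[OF H(2)] by simp
  qed
  then obtain k where k: "H \<inter> lower_central_series G (Suc k) \<subseteq> {\<one>}"
      "\<not> H \<inter> lower_central_series G k \<subseteq> {\<one>}"
    using nilpotent_last_layer[OF nil Hc, of "{\<one>}"] by blast
  define M where "M = lower_central_series G (Suc k)"
  have M: "M \<lhd> G" unfolding M_def by (rule lower_central_series_normal)
  have Ms: "subgroup M G" using M by (rule normal_imp_subgroup)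
  obtain h where h: "h \<in> H" "h \<in> lower_central_series G k" "h \<noteq> \<one>" using k(2) by blast
  have hM: "h \<notin> M" using k(1) h unfolding M_def by blast
  have hc: "h \<in> carrier G" using h(1) Hc by blast
  \<comment> \<open>The permutation that is trivial on \<open>G/H\<close> and acts as \<open>h\<close> on \<open>G/M\<close> lies in the 2-closure
     because \<open>h\<close> is central modulo \<open>M\<close>.\<close>
  have "\<exists>g \<in> carrier G. \<forall>i \<in> (UNIV :: bool set). \<forall>a \<in> carrier G.
      inv a \<otimes> (inv (if i then \<one> else h) \<otimes> g) \<otimes> a \<in> (if i then H else M)"
  proof (rule coset_family_rigid[OF tc])
    show "subgroup (if i then H else M) G" for i using H(1) Ms by simp
    show "(if i then \<one> else h) \<in> carrier G" for i using hc by simp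
    show "g = \<one>" if "g \<in> carrier G"
      "\<And>i a. i \<in> (UNIV :: bool set) \<Longrightarrow> a \<in> carrier G \<Longrightarrow> inv a \<otimes> g \<otimes> a \<in> (if i then H else M)" for g
      using that(1) that(2)[of True] by (intro C1) (simp add: C_def)
    have mixed: "\<exists>g \<in> carrier G. inv a \<otimes> (inv \<one> \<otimes> g) \<otimes> a \<in> H \<and> inv b \<otimes> (inv h \<otimes> g) \<otimes> b \<in> M"
      if a: "a \<in> carrier G" and b: "b \<in> carrier G" for a b
    proof (intro bexI conjI)
      \<comment> \<open>The conjugate of \<open>h\<close> by \<open>a\<close> fixes the coset of
        \<open>a\<close> in \<open>G/H\<close>, as the identity does; it differs from
        \<open>h\<close> by a commutator in \<open>M\<close>, so both act alike on
        \<open>G/M\<close>.\<close>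
      show "a \<otimes> h \<otimes> inv a \<in> carrier G" using a hc by simp
      show "inv a \<otimes> (inv \<one> \<otimes> (a \<otimes> h \<otimes> inv a)) \<otimes> a \<in> H" using a h(1) hc by (simp add: m_assoc)
      have "inv h \<in> lower_central_series G k"
        using subgroup.m_inv_closed[OF normal_imp_subgroup[OF lower_central_series_normal] h(2)] .
      then have "inv h \<otimes> a \<otimes> inv (inv h) \<otimes> inv a \<in> M"
        unfolding M_def using a by (rule lower_central_series_commutator)
      then have "inv h \<otimes> (a \<otimes> h \<otimes> inv a) \<in> M" using a hc by (simp add: m_assoc)
      then show "inv b \<otimes> (inv h \<otimes> (a \<otimes> h \<otimes> inv a)) \<otimes> b \<in> M"
        by (rule normal.inv_op_closed1[OF M b])
    qed
    show "\<exists>g \<in> carrier G. inv a \<otimes> (inv (if i then \<one> else h) \<otimes> g) \<otimes> a \<in> (if i then H else M)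
        \<and> inv b \<otimes> (inv (if j then \<one> else h) \<otimes> g) \<otimes> b \<in> (if j then H else M)"
      if "a \<in> carrier G" "b \<in> carrier G" for i j a b
    proof (cases "i = j")
      case True
      then show ?thesis using that hc subgroup.one_closed[OF H(1)] subgroup.one_closed[OF Ms]
        by (intro bexI[of _ "if i then \<one> else h"]) auto
    next
      case False
      then show ?thesis using mixed[OF that] mixed[OF that(2,1)] by (cases i) auto
    qed
  qed simp
  \<comment> \<open>A single element inducing this permutation fixes every coset of
    \<open>H\<close>, so it is trivial; acting as \<open>h\<close> on \<open>G/M\<close>, it would
    put \<open>h\<close> into \<open>M\<close>.\<close>
  then obtain g where g: "g \<in> carrier G" and gi: "\<forall>i \<in> UNIV. \<forall>a \<in> carrier G.
      inv a \<otimes> (inv (if i then \<one> else h) \<otimes> g) \<otimes> a \<in> (if i then H else M)" by (elim bexE)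
  have "g = \<one>" using bspec[OF gi, of True] g by (intro C1) (simp add: C_def)
  then have "inv h \<in> M" using bspec[OF bspec[OF gi, of False], of \<one>] hc by simp
  then show False using hM hc subgroup.m_inv_closed[OF Ms, of "inv h"] by simp
qed

lemma (in group) prime_card_subgroup_unique:
  assumes nil: "nilpotent_group G" and tc: "totally_2_closed G" and p: "Factorial_Ring.prime p"
    and H: "subgroup H G" "card H = p" and K: "subgroup K G" "card K = p"
  shows "H = K"
proof (rule ccontr)
  assume ne: "H \<noteq> K"
  have fin: "finite (carrier G)" using tc by (simp add: totally_2_closed_def)
  have Hn: "H \<lhd> G" and Kn: "K \<lhd> G"
    using prime_card_subgroup_normal[OF nil tc H(1)] prime_card_subgroup_normal[OF nil tc K(1)] H(2) K(2) p
    by simp_all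
  have HK: "g = \<one>" if "g \<in> H" "g \<in> K" for g
  proof (rule ccontr)
    assume g: "g \<noteq> \<one>"
    have I: "subgroup (H \<inter> K) G" using H K by (intro subgroups_Inter_pair)
    have "H \<inter> K = H"
      by (rule prime_card_subgroup_eq[OF H(1) _ I _ _ g]) (use that p H(2) in auto)
    moreover have "H \<inter> K = K"
      by (rule prime_card_subgroup_eq[OF K(1) _ I _ _ g]) (use that p K(2) in auto)
    ultimately show False using ne by blast
  qed
  have nontriv: "\<exists>x \<in> N. x \<noteq> \<one>" if "card N = p" for N
  proof (rule ccontr)
    assume "\<not> (\<exists>x \<in> N. x \<noteq> \<one>)"
    then have "card N \<le> 1" using card_mono[of "{\<one>}" N] by auto
    then show False using that prime_gt_1_nat[OF p] by simp
  qed
  obtain x where x: "x \<in> H" "x \<noteq> \<one>" using nontriv[OF H(2)] by blast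
  obtain y where y: "y \<in> K" "y \<noteq> \<one>" using nontriv[OF K(2)] by blast
  have xc: "x \<in> carrier G" and yc: "y \<in> carrier G"
    using subgroup.mem_carrier[OF H(1) x(1)] subgroup.mem_carrier[OF K(1) y(1)] .
  have pow: "z [^] p = \<one>" if z: "z \<in> N" and N: "subgroup N G" "card N = p" for z N
  proof -
    interpret N: group "G\<lparr>carrier := N\<rparr>" using N(1) by (rule subgroup_imp_group)
    have "z [^]\<^bsub>G\<lparr>carrier := N\<rparr>\<^esub> p = \<one>"
      using N.pow_order_eq_1[of z] z N(2) by (simp add: order_def)
    then show ?thesis by (simp only: nat_pow_consistent[of z p N])
  qed
  have comm: "x \<otimes> y = y \<otimes> x"
  proof -
    have "y \<otimes> inv x \<otimes> inv y \<in> H"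
      using normal.inv_op_closed2[OF Hn yc subgroup.m_inv_closed[OF H(1) x(1)]] .
    then have 1: "x \<otimes> (y \<otimes> inv x \<otimes> inv y) \<in> H"
      by (rule subgroup.m_closed[OF H(1) x(1)])
    have "x \<otimes> y \<otimes> inv x \<in> K"
      using normal.inv_op_closed2[OF Kn xc y(1)] .
    then have 2: "(x \<otimes> y \<otimes> inv x) \<otimes> inv y \<in> K"
      using subgroup.m_inv_closed[OF K(1) y(1)] by (rule subgroup.m_closed[OF K(1)])
    have "(x \<otimes> y \<otimes> inv x) \<otimes> inv y = \<one>"
      using HK[OF _ 2] 1 xc yc by (simp add: m_assoc)
    then have "inv (inv y) = x \<otimes> y \<otimes> inv x" using xc yc by (intro inv_equality) auto
    then have "y \<otimes> x = x \<otimes> y \<otimes> inv x \<otimes> x" using yc by simp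
    then show ?thesis using xc yc by (simp add: m_assoc)
  qed
  define z where "z = x \<otimes> y"
  have zc: "z \<in> carrier G" using xc yc by (simp add: z_def)
  have z1: "z \<noteq> \<one>"
  proof
    assume "z = \<one>"
    then have "x \<otimes> y = \<one>" by (simp add: z_def)
    then have "inv y = x" using yc xc by (rule inv_equality)
    then have "x \<in> K" using subgroup.m_inv_closed[OF K(1) y(1)] by simp
    then show False using HK[OF x(1)] x(2) by blast
  qed
  have "z [^] p = \<one>"
    using pow[OF x(1) H] pow[OF y(1) K] pow_mult_distrib[OF comm xc yc, of p] by (simp add: z_def)
  then have "ord z dvd p" using pow_eq_id[OF zc, of p] by blast
  moreover have "ord z \<noteq> 1" using ord_eq_1[OF zc] z1 by blast
  ultimately have ordz: "ord z = p" using p prime_nat_iff by blast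
  define L where "L = generate G {z}"
  have L: "subgroup L G" using zc by (simp add: L_def generate_is_subgroup)
  have Lp: "card L = p" using generate_pow_card[OF zc] ordz by (simp add: L_def)
  have Ln: "L \<lhd> G" by (rule prime_card_subgroup_normal[OF nil tc L]) (use Lp p in simp)
  have zL: "z \<in> L" unfolding L_def using zc by (rule generate_singleton_mem)
  define F where "F i = (if i = 0 then H else if i = 1 then K else L)" for i :: nat
  define h where "h i = (if i = 2 then x else \<one>)" for i :: nat
  have F: "F i \<lhd> G" for i using Hn Kn Ln by (simp add: F_def)
  have hc: "h i \<in> carrier G" for i using xc by (simp add: h_def)
  \<comment> \<open>Here the permutation is trivial on \<open>G/H\<close> and \<open>G/K\<close>, and acts as \<open>x\<close> on the cosets of
     the third subgroup \<open>L = \<langle>x y\<rangle>\<close>.\<close>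
  have "\<exists>g \<in> carrier G. \<forall>i \<in> {0, 1, 2}. \<forall>a \<in> carrier G. inv a \<otimes> (inv (h i) \<otimes> g) \<otimes> a \<in> F i"
  proof (rule coset_family_rigid[OF tc])
    show "subgroup (F i) G" for i using F by (rule normal_imp_subgroup)
    show "h i \<in> carrier G" for i by (rule hc)
    show "g = \<one>" if "g \<in> carrier G"
      "\<And>i a. i \<in> {0, 1, 2} \<Longrightarrow> a \<in> carrier G \<Longrightarrow> inv a \<otimes> g \<otimes> a \<in> F i" for g
      using that(1) that(2)[of 0 \<one>] that(2)[of 1 \<one>] by (intro HK) (auto simp: F_def)
    fix i j a b assume i: "i \<in> {0, 1, 2 :: nat}" and j: "j \<in> {0, 1, 2 :: nat}"
      and a: "a \<in> carrier G" and b: "b \<in> carrier G"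
    have "inv x \<otimes> inv y \<in> L"
      using subgroup.m_inv_closed[OF L zL] comm xc yc by (simp add: z_def inv_mult_group)
    moreover have "inv y \<in> K" using subgroup.m_inv_closed[OF K(1) y(1)] .
    moreover note subgroup.one_closed[OF H(1)] subgroup.one_closed[OF K(1)] subgroup.one_closed[OF L]
    \<comment> \<open>By cases: \<open>\<one>\<close> serves the pair \<open>H\<close>,
      \<open>K\<close>; \<open>x\<close> lies in \<open>H\<close> and equals \<open>h 2\<close>, so
      it serves \<open>H\<close>, \<open>L\<close>; \<open>inv y\<close> lies in \<open>K\<close>,
      and \<open>inv x \<otimes> inv y\<close> is the inverse of \<open>z\<close> in
      \<open>L\<close>, so it serves \<open>K\<close>, \<open>L\<close>.\<close>
    ultimately have "\<exists>g \<in> carrier G. inv (h i) \<otimes> g \<in> F i \<and> inv (h j) \<otimes> g \<in> F j"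
      using i j xc yc x(1)
      by (intro bexI[of _ "if i = j then h i else if i = 0 \<or> j = 0 then (if i = 2 \<or> j = 2 then x else \<one>) else inv y"])
        (auto simp: F_def h_def)
    then obtain g where "g \<in> carrier G" "inv (h i) \<otimes> g \<in> F i" "inv (h j) \<otimes> g \<in> F j" by blast
    then show "\<exists>g \<in> carrier G. inv a \<otimes> (inv (h i) \<otimes> g) \<otimes> a \<in> F i \<and> inv b \<otimes> (inv (h j) \<otimes> g) \<otimes> b \<in> F j"
      using normal.inv_op_closed1[OF F a] normal.inv_op_closed1[OF F b] by blast
  qed simp
  then obtain g where g: "g \<in> carrier G"
    and gi: "\<forall>i \<in> {0, 1, 2}. \<forall>a \<in> carrier G. inv a \<otimes> (inv (h i) \<otimes> g) \<otimes> a \<in> F i" by (elim bexE)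
  have gF: "inv (h i) \<otimes> g \<in> F i" if "i \<in> {0, 1, 2}" for i
    using bspec[OF bspec[OF gi that], of \<one>] g hc by simp
  have "g = \<one>" using gF[of 0] gF[of 1] g by (intro HK) (simp_all add: F_def h_def)
  then have "inv x \<in> L" using gF[of 2] xc by (simp add: F_def h_def)
  then have xL: "x \<in> L" using subgroup.m_inv_closed[OF L, of "inv x"] xc by simp
  have I: "subgroup (H \<inter> L) G" using H L by (intro subgroups_Inter_pair)
  have "H \<inter> L = H"
    by (rule prime_card_subgroup_eq[OF H(1) _ I _ _ x(2)]) (use x(1) xL p H(2) in auto)
  moreover have "H \<inter> L = L"
    by (rule prime_card_subgroup_eq[OF L _ I _ _ x(2)]) (use x(1) xL p Lp in auto)
  ultimately have "z \<in> H" using zL by blast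
  from subgroup.m_closed[OF H(1) subgroup.m_inv_closed[OF H(1) x(1)] this]
  have "y \<in> H" using xc yc by (simp add: z_def)
  then show False using HK[OF _ y(1)] y(2) by blast
qed

text \<open>Uniqueness of the subgroup of order \<open>p\<close>, phrased for elements. Everything
  that follows draws on total 2-closure through this statement alone.\<close>

lemma (in group) prime_order_generate:
  fixes p :: nat
  assumes nil: "nilpotent_group G" and tc: "totally_2_closed G" and p: "Factorial_Ring.prime p"
    and x: "x \<in> carrier G" "x [^] p = \<one>" "x \<noteq> \<one>" and y: "y \<in> carrier G" "y [^] p = \<one>"
  shows "y \<in> generate G {x}"
proof (cases "y = \<one>")
  case True
  then show ?thesis by (simp add: generate.one)
next
  case False
  have card: "card (generate G {w}) = p" if "w \<in> carrier G" "w [^] p = \<one>" "w \<noteq> \<one>" for w :: 'a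
  proof -
    have "ord w dvd p" "ord w \<noteq> 1"
      using pow_eq_id[OF that(1), of p] ord_eq_1[OF that(1)] that(2,3) by blast+
    then have "ord w = p" using p prime_nat_iff by blast
    then show ?thesis using generate_pow_card[OF that(1)] by simp
  qed
  have sg: "subgroup (generate G {w}) G" if "w \<in> carrier G" for w
    using that by (simp add: generate_is_subgroup)
  have "generate G {x} = generate G {y}"
    by (rule prime_card_subgroup_unique[OF nil tc p sg[OF x(1)] card[OF x] sg[OF y(1)] card[OF y False]])
  then show ?thesis using generate_singleton_mem[OF y(1)] by simp
qed

section \<open>A self-centralizing cyclic normal subgroup\<close>

lemma (in group) conj_int_pow:
  assumes x: "x \<in> carrier G" and a: "a \<in> carrier G"
  shows "x \<otimes> a [^] (i::int) \<otimes> inv x = (x \<otimes> a \<otimes> inv x) [^] i"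
proof -
  have "(\<lambda>z. x \<otimes> z \<otimes> inv x) \<in> hom G G"
    using x by (intro homI) (simp_all add: m_assoc)
  from Group.hom_int_pow[OF this a is_group is_group, of i] show ?thesis by simp
qed

text \<open>Moving \<open>x\<close> to the right past a power of \<open>a\<close> multiplies the
  exponent by \<open>k\<close>. Collecting the factors \<open>a [^] t\<close> of the power on the
  left thus produces the geometric sum.\<close>

lemma (in group) twisted_pow:
  fixes k i t :: int and n :: nat
  assumes x: "x \<in> carrier G" and a: "a \<in> carrier G" and xa: "x \<otimes> a \<otimes> inv x = a [^] k"
  shows "x [^] n \<otimes> a [^] i = a [^] (k ^ n * i) \<otimes> x [^] n"
    and "(a [^] t \<otimes> x) [^] n = a [^] (t * (\<Sum>j<n. k ^ j)) \<otimes> x [^] n"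
proof -
  have step: "x \<otimes> a [^] i = a [^] (k * i) \<otimes> x" for i :: int
  proof -
    have "x \<otimes> a [^] i \<otimes> inv x = a [^] (k * i)"
      using conj_int_pow[OF x a, of i] a by (simp add: xa int_pow_pow)
    then have "a [^] (k * i) \<otimes> x = x \<otimes> a [^] i \<otimes> inv x \<otimes> x" by simp
    then show ?thesis using x a by (simp add: m_assoc)
  qed
  have pow: "x [^] n \<otimes> a [^] i = a [^] (k ^ n * i) \<otimes> x [^] n" for n :: nat and i :: int
  proof (induction n arbitrary: i)
    case 0
    show ?case using a by simp
  next
    case (Suc n)
    have "x [^] Suc n \<otimes> a [^] i = x [^] n \<otimes> (x \<otimes> a [^] i)" using x a by (simp add: m_assoc)
    also have "\<dots> = (x [^] n \<otimes> a [^] (k * i)) \<otimes> x" using x a by (simp add: step m_assoc)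
    also have "\<dots> = a [^] (k ^ Suc n * i) \<otimes> x [^] Suc n"
      using x a by (simp add: Suc m_assoc mult.assoc mult.left_commute)
    finally show ?case .
  qed
  show "x [^] n \<otimes> a [^] i = a [^] (k ^ n * i) \<otimes> x [^] n" by (rule pow)
  show "(a [^] t \<otimes> x) [^] n = a [^] (t * (\<Sum>j<n. k ^ j)) \<otimes> x [^] n"
  proof (induction n)
    case 0
    show ?case by simp
  next
    case (Suc n)
    have "(a [^] t \<otimes> x) [^] Suc n = a [^] (t * (\<Sum>j<n. k ^ j)) \<otimes> (x [^] n \<otimes> a [^] t) \<otimes> x"
      using x a Suc by (simp add: m_assoc)
    also have "\<dots> = (a [^] (t * (\<Sum>j<n. k ^ j)) \<otimes> a [^] (k ^ n * t)) \<otimes> (x [^] n \<otimes> x)"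
      using x a by (simp add: pow m_assoc)
    also have "a [^] (t * (\<Sum>j<n. k ^ j)) \<otimes> a [^] (k ^ n * t) = a [^] (t * (\<Sum>j<Suc n. k ^ j))"
      using a by (simp add: int_pow_mult[symmetric] algebra_simps)
    finally show ?case by simp
  qed
qed

lemma (in group) generate_singleton_iff:
  "a \<in> carrier G \<Longrightarrow> y \<in> generate G {a} \<longleftrightarrow> (\<exists>i::int. y = a [^] i)"
  by (auto simp: generate_pow)

text \<open>Descent: split off a prime \<open>p\<close> of \<open>n\<close>. Either the power of
  \<open>x\<close> with exponent \<open>n / p\<close> is still in \<open>A\<close> and this exponent
  replaces \<open>n\<close>, or it lies outside \<open>A\<close> while its \<open>p\<close>-th power
  lies inside.\<close>

lemma (in group) prime_power_step:
  assumes A: "subgroup A G" and x: "x \<in> carrier G" "x \<notin> A" and n: "x [^] (n::nat) \<in> A" "n > 0"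
  obtains p q :: nat where "Factorial_Ring.prime p" "x [^] q \<notin> A" "(x [^] q) [^] p \<in> A"
  using n
proof (induction n arbitrary: thesis rule: less_induct)
  case (less n)
  have "n \<noteq> 1" using less.prems(2) x by auto
  then obtain p where p: "Factorial_Ring.prime p" "p dvd n" using prime_factor_nat by blast
  then obtain q where q: "n = q * p" by (metis dvd_def mult.commute)
  show ?case
  proof (cases "x [^] q \<in> A")
    case True
    have "q < n" "q > 0" using q less.prems(3) prime_gt_1_nat[OF p(1)] by auto
    then show ?thesis using less.IH[of q] True less.prems(1) by blast
  next
    case False
    moreover have "(x [^] q) [^] p \<in> A" using x(1) less.prems(2) q by (simp add: nat_pow_pow)
    ultimately show ?thesis using less.prems(1) p(1) by blast
  qed
qed

section \<open>Nilpotent groups with at most one subgroup of each prime order\<close>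

locale unique_prime_subgroups = group G for G (structure) +
  assumes fin: "finite (carrier G)" and nil: "nilpotent_group G"
    and prime_order: "\<And>(p::nat) x y. Factorial_Ring.prime p \<Longrightarrow> x \<in> carrier G \<Longrightarrow> x [^] p = \<one> \<Longrightarrow>
      x \<noteq> \<one> \<Longrightarrow> y \<in> carrier G \<Longrightarrow> y [^] p = \<one> \<Longrightarrow> y \<in> generate G {x}"
begin

lemma ord_positive: "a \<in> carrier G \<Longrightarrow> ord a > 0"
  using ord_ge_1[OF fin, of a] by simp

text \<open>The power of \<open>a\<close> with exponent \<open>ord a div p\<close> has order
  \<open>p\<close>, and by uniqueness it generates every element whose \<open>p\<close>-th power is
  trivial.\<close>

lemma prime_order_mem:
  assumes a: "a \<in> carrier G" and p: "Factorial_Ring.prime p" "p dvd ord a"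
    and y: "y \<in> carrier G" "y [^] p = \<one>"
  shows "y \<in> generate G {a}"
proof -
  define w where "w = a [^] (ord a div p)"
  have w: "w \<in> carrier G" using a by (simp add: w_def)
  have "w [^] p = a [^] (ord a)" using a p(2) by (simp add: w_def nat_pow_pow)
  then have wp: "w [^] p = \<one>" using a by simp
  have "\<not> ord a dvd ord a div p"
  proof
    assume "ord a dvd ord a div p"
    moreover have "ord a div p > 0" using p ord_positive[OF a] by (simp add: div_greater_zero_iff dvd_imp_le prime_gt_0_nat)
    ultimately have "ord a \<le> ord a div p" by (rule dvd_imp_le)
    moreover have "ord a div p < ord a"
      using ord_positive[OF a] prime_gt_1_nat[OF p(1)] by (intro div_less_dividend) auto
    ultimately show False by linarith
  qed
  then have "w \<noteq> \<one>" using pow_eq_id[OF a] by (simp add: w_def)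
  from prime_order[OF p(1) w wp this y] have "y \<in> generate G {w}" .
  moreover have "w \<in> generate G {a}"
    unfolding w_def generate_singleton_iff[OF a] int_pow_int[symmetric] by blast
  then have "generate G {w} \<subseteq> generate G {a}"
    using a by (intro generate_subgroup_incl) (simp_all add: generate_is_subgroup)
  ultimately show ?thesis by blast
qed

text \<open>Among the elements that generate a normal subgroup, take \<open>a\<close> of maximal
  order. If the centralizer \<open>C\<close> of \<open>a\<close> exceeded \<open>A\<close>, an
  element of \<open>C\<close> outside \<open>A\<close>, as deep as possible in the lower central
  series, would lead either to a larger cyclic normal subgroup or to an element of prime order
  outside \<open>A\<close> that uniqueness puts into \<open>A\<close>.\<close>

lemma exists_self_centralizing_cyclic:
  obtains a where "a \<in> carrier G" "generate G {a} \<lhd> G"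
    "\<And>x. x \<in> carrier G \<Longrightarrow> x \<otimes> a = a \<otimes> x \<Longrightarrow> x \<in> generate G {a}"
proof -
  define S where "S = {a \<in> carrier G. generate G {a} \<lhd> G}"
  have finS: "finite (ord ` S)" using fin by (simp add: S_def)
  have "\<one> \<in> S"
    using one_is_normal by (simp add: S_def generate_one)
  then have "ord ` S \<noteq> {}" by blast
  from Max_in[OF finS this] obtain a where aS: "a \<in> S" and max: "ord a = Max (ord ` S)" by auto
  have max: "ord b \<le> ord a" if "b \<in> S" for b
    unfolding max by (rule Max_ge[OF finS]) (use that in blast)
  define A where "A = generate G {a}"
  define m where "m = int (ord a)"
  have a: "a \<in> carrier G" and An: "A \<lhd> G" using aS by (simp_all add: S_def A_def)
  have m0: "m > 0" using ord_positive[OF a] by (simp add: m_def)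
  have A: "subgroup A G" using An by (rule normal_imp_subgroup)
  have Ac: "b \<in> carrier G" if "b \<in> A" for b using subgroup.mem_carrier[OF A that] .
  have A_iff: "b \<in> A \<longleftrightarrow> (\<exists>i::int. b = a [^] i)" for b
    unfolding A_def using a by (rule generate_singleton_iff)
  define C where "C = {x \<in> carrier G. x \<otimes> a = a \<otimes> x}"
  have C_A: "x \<otimes> b = b \<otimes> x" if x: "x \<in> C" and b: "b \<in> A" for x b
  proof -
    obtain i :: int where i: "b = a [^] i" using b A_iff by blast
    have xc: "x \<in> carrier G" and xa: "x \<otimes> a = a \<otimes> x" using x by (simp_all add: C_def)
    have "x \<otimes> a \<otimes> inv x = a" using xc a by (simp add: xa m_assoc)
    then have "b = x \<otimes> b \<otimes> inv x" using conj_int_pow[OF xc a, of i] by (simp add: i)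
    then have "b \<otimes> x = x \<otimes> b \<otimes> inv x \<otimes> x" by simp
    then show ?thesis using xc Ac[OF b] by (simp add: m_assoc)
  qed
  have "C \<subseteq> A"
  proof (rule ccontr)
    assume nCA: "\<not> C \<subseteq> A"
    have CG: "C \<subseteq> carrier G" by (auto simp: C_def)
    obtain l where l: "C \<inter> lower_central_series G (Suc l) \<subseteq> A" "\<not> C \<inter> lower_central_series G l \<subseteq> A"
      using nilpotent_last_layer[OF nil CG subgroup.one_closed[OF A] nCA] by blast
    then obtain x where xC: "x \<in> C" and xl: "x \<in> lower_central_series G l" and xA: "x \<notin> A" by blast
    have x: "x \<in> carrier G" and xa: "x \<otimes> a = a \<otimes> x" using xC by (simp_all add: C_def)
    \<comment> \<open>The commutator of \<open>x\<close> and \<open>g\<close> again centralizes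
      \<open>a\<close>, as \<open>A\<close> is normal, and lies one layer deeper than
      \<open>x\<close>, so the choice of \<open>l\<close> puts it into \<open>A\<close>. Hence
      \<open>x\<close> is central modulo \<open>A\<close>.\<close>
    have comm: "g \<otimes> x \<otimes> inv g \<otimes> inv x \<in> A" if g: "g \<in> carrier G" for g
    proof -
      define z where "z = g \<otimes> inv x \<otimes> inv g"
      define b where "b = inv g \<otimes> a \<otimes> g"
      have zc: "z \<in> carrier G" using g x by (simp add: z_def)
      have b: "b \<in> A" unfolding b_def
        by (rule normal.inv_op_closed1[OF An g]) (use generate_singleton_mem[OF a] in \<open>simp add: A_def\<close>)
      have bc: "b \<in> carrier G" using Ac[OF b] .
      have "inv x \<otimes> b = inv x \<otimes> (b \<otimes> x) \<otimes> inv x" using x bc by (simp add: m_assoc)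
      also have "\<dots> = b \<otimes> inv x" using x bc by (simp add: C_A[OF xC b, symmetric] m_assoc)
      finally have "g \<otimes> (inv x \<otimes> b) \<otimes> inv g = g \<otimes> (b \<otimes> inv x) \<otimes> inv g" by simp
      then have za: "z \<otimes> a = a \<otimes> z" using g x a by (simp add: z_def b_def m_assoc)
      have "x \<otimes> z \<otimes> a = x \<otimes> a \<otimes> z" using x zc a by (simp add: m_assoc za)
      then have "x \<otimes> z \<in> C" using x zc a by (simp add: C_def xa m_assoc)
      moreover have "x \<otimes> g \<otimes> inv x \<otimes> inv g = x \<otimes> z" using x g by (simp add: z_def m_assoc)
      then have "x \<otimes> z \<in> lower_central_series G (Suc l)"
        using lower_central_series_commutator[OF xl g] by (simp only:)
      ultimately have "x \<otimes> z \<in> A" using l(1) by blast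
      from subgroup.m_inv_closed[OF A this] show ?thesis
        using x g by (simp add: z_def inv_mult_group m_assoc)
    qed
    have "x [^] ord x \<in> A" using subgroup.one_closed[OF A] x by simp
    then obtain p q :: nat where p: "Factorial_Ring.prime p" and yA: "x [^] q \<notin> A" and yp: "(x [^] q) [^] p \<in> A"
      using prime_power_step[OF A x xA _ ord_positive[OF x]] by blast
    define y where "y = x [^] q"
    have y: "y \<in> carrier G" using x by (simp add: y_def)
    have ya: "y \<otimes> a = a \<otimes> y" unfolding y_def using group_commutes_pow[OF xa x a] .
    obtain s :: int where s: "y [^] p = a [^] s" using yp unfolding y_def[symmetric] A_iff by blast
    \<comment> \<open>\<open>y\<close> inherits centrality modulo \<open>A\<close> from
      \<open>x\<close>, and so do the elements \<open>a [^] t \<otimes> y\<close>; such an element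
      generates a normal subgroup as soon as that subgroup contains \<open>A\<close>.\<close>
    have conj_y: "\<exists>d \<in> A. g \<otimes> (a [^] t \<otimes> y) \<otimes> inv g = d \<otimes> (a [^] t \<otimes> y)"
      if g: "g \<in> carrier G" for g and t :: int
    proof -
      define b where "b = g \<otimes> x \<otimes> inv g \<otimes> inv x"
      have b: "b \<in> A" unfolding b_def by (rule comm[OF g])
      have bc: "b \<in> carrier G" using Ac[OF b] .
      have "g \<otimes> x \<otimes> inv g = b \<otimes> x" using g x by (simp add: b_def m_assoc)
      then have "g \<otimes> y \<otimes> inv g = (b \<otimes> x) [^] q"
        using conj_int_pow[OF g x, of "int q"] by (simp add: y_def int_pow_int)
      also have "\<dots> = b [^] q \<otimes> y"
        unfolding y_def by (rule pow_mult_distrib[OF C_A[OF xC b, symmetric] bc x])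
      finally have gy: "g \<otimes> y \<otimes> inv g = b [^] q \<otimes> y" .
      define c where "c = g \<otimes> a [^] t \<otimes> inv g"
      have atA: "a [^] t \<in> A" using A_iff by blast
      have cA: "c \<in> A" unfolding c_def by (rule normal.inv_op_closed2[OF An g atA])
      have bq: "b [^] q \<in> A"
        using subgroup_int_pow_closed[OF A b, of "int q"] by (simp add: int_pow_int)
      define d where "d = c \<otimes> b [^] q \<otimes> inv (a [^] t)"
      have "d \<in> A" unfolding d_def
        by (intro subgroup.m_closed[OF A] cA bq subgroup.m_inv_closed[OF A atA])
      moreover have "g \<otimes> (a [^] t \<otimes> y) \<otimes> inv g = c \<otimes> (g \<otimes> y \<otimes> inv g)"
        using g a y by (simp add: c_def m_assoc)
      then have "g \<otimes> (a [^] t \<otimes> y) \<otimes> inv g = d \<otimes> (a [^] t \<otimes> y)"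
        using Ac[OF cA] bc a y by (simp add: gy d_def m_assoc)
      ultimately show ?thesis by blast
    qed
    have zp: "(a [^] t \<otimes> y) [^] p = a [^] (s + t * int p)" for t :: int
    proof -
      have "y \<otimes> a \<otimes> inv y = a [^] (1::int)" using y a by (simp add: ya m_assoc)
      from twisted_pow(2)[OF y a this, of t p] show ?thesis
        using a by (simp add: s int_pow_mult[symmetric] add.commute)
    qed
    have zA: "a [^] t \<otimes> y \<notin> A" for t :: int
    proof
      assume "a [^] t \<otimes> y \<in> A"
      moreover have "inv (a [^] t) \<in> A" using A_iff subgroup.m_inv_closed[OF A] by blast
      ultimately have "inv (a [^] t) \<otimes> (a [^] t \<otimes> y) \<in> A" using subgroup.m_closed[OF A] by blast
      then show False using yA y a by (simp add: y_def)
    qed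
    \<comment> \<open>If \<open>s + t p\<close> can be made prime to \<open>m\<close>, then
      \<open>z [^] p\<close> generates \<open>A\<close>, and \<open>z\<close> generates a strictly
      larger cyclic normal subgroup. Otherwise a prime divides \<open>m\<close>, \<open>p\<close>
      and \<open>s\<close>, so it is \<open>p\<close>, and some \<open>a [^] t \<otimes> y\<close>
      outside \<open>A\<close> has trivial \<open>p\<close>-th power.\<close>
    show False
    proof (cases "\<exists>t. coprime (s + t * int p) m")
      case True
      then obtain t where t: "coprime (s + t * int p) m" by blast
      define z where "z = a [^] t \<otimes> y"
      have z: "z \<in> carrier G" using a y by (simp add: z_def)
      define B where "B = generate G {z}"
      have B: "subgroup B G" using z by (simp add: B_def generate_is_subgroup)
      have zB: "z \<in> B" unfolding B_def using z by (rule generate_singleton_mem)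
      obtain u v where uv: "u * (s + t * int p) + v * m = 1"
        using bezout_int[of "s + t * int p" m] t by auto
      have "(z [^] p) [^] u = a [^] ((s + t * int p) * u)"
        using a zp[of t] by (simp add: z_def int_pow_pow)
      also have "\<dots> = a [^] (1::int)"
        unfolding int_pow_eq[OF a] m_def[symmetric] uv[symmetric] by (simp add: mult.commute)
      finally have "a = (z [^] int p) [^] u" using a by (simp add: int_pow_int)
      then have "a \<in> B" using subgroup_int_pow_closed[OF B] zB by metis
      then have AB: "A \<subseteq> B" unfolding A_def using B by (intro generate_subgroup_incl) simp_all
      have "B \<lhd> G" unfolding normal_inv_iff
      proof (intro conjI ballI B)
        fix g w assume g: "g \<in> carrier G" and w: "w \<in> B"
        obtain i :: int where i: "w = z [^] i" using w generate_singleton_iff[OF z] by (auto simp: B_def)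
        obtain d where d: "d \<in> A" "g \<otimes> z \<otimes> inv g = d \<otimes> z" using conj_y[OF g, of t] z_def by blast
        then have "d \<otimes> z \<in> B" using AB subgroup.m_closed[OF B _ zB] by blast
        then show "g \<otimes> w \<otimes> inv g \<in> B"
          unfolding i conj_int_pow[OF g z] d(2) by (rule subgroup_int_pow_closed[OF B])
      qed
      then have "z \<in> S" using z by (simp add: S_def B_def)
      from max[OF this] have "card B \<le> card A"
        using generate_pow_card[OF z] generate_pow_card[OF a] by (simp add: A_def B_def)
      moreover have "finite B" using fin subgroup.subset[OF B] finite_subset by blast
      ultimately have "A = B" using AB card_seteq by blast
      then show False using zB zA[of t] by (simp add: z_def)
    next
      case False
      then obtain r :: int where r: "Factorial_Ring.prime r" "r dvd m" "r dvd int p" "r dvd s"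
        using coprime_shift_exists[of m "int p" s] m0 by auto
      have "r = int p" using r(1,3) p by (intro primes_dvd_imp_eq) simp_all
      then have pm: "int p dvd m" "int p dvd s" using r by simp_all
      then have "gcd (int p) m dvd s" by (meson dvd_trans gcd_dvd1)
      then obtain t where "m dvd s + t * int p" using linear_cong_solvable by blast
      then have "(a [^] t \<otimes> y) [^] p = \<one>"
        unfolding zp int_pow_eq_id[OF a] m_def .
      then have "a [^] t \<otimes> y \<in> A"
        unfolding A_def using a y p pm(1) by (intro prime_order_mem) (simp_all add: m_def)
      then show False using zA by blast
    qed
  qed
  show thesis
  proof (rule that)
    show "a \<in> carrier G" by (rule a)
    show "generate G {a} \<lhd> G" using An by (simp add: A_def)
    show "x \<in> generate G {a}" if "x \<in> carrier G" "x \<otimes> a = a \<otimes> x" for x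
      using \<open>C \<subseteq> A\<close> that by (auto simp: C_def A_def)
  qed
qed

end

section \<open>The action on a self-centralizing cyclic normal subgroup\<close>

locale self_centralizing_cyclic = unique_prime_subgroups +
  fixes a
  assumes a: "a \<in> carrier G" and normal_A: "generate G {a} \<lhd> G"
    and central: "\<And>x. x \<in> carrier G \<Longrightarrow> x \<otimes> a = a \<otimes> x \<Longrightarrow> x \<in> generate G {a}"
begin

abbreviation "A \<equiv> generate G {a}"
abbreviation "m \<equiv> int (ord a)"

lemma A_iff: "y \<in> A \<longleftrightarrow> (\<exists>i::int. y = a [^] i)"
  using a by (rule generate_singleton_iff)

lemma subgroup_A: "subgroup A G"
  using normal_A by (rule normal_imp_subgroup)

lemma pow_mem_A: "a [^] (i::int) \<in> A"
  using A_iff by blast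

lemma m_positive: "m > 0"
  using ord_positive[OF a] by simp

lemma act_exists:
  assumes "g \<in> carrier G"
  shows "\<exists>k::int. g \<otimes> a \<otimes> inv g = a [^] k"
  using normal.inv_op_closed2[OF normal_A assms generate_singleton_mem[OF a]] A_iff by blast

text \<open>
  The iterated commutators of \<open>a\<close> with \<open>g\<close> are the powers \<open>a\<close> to the exponent \<open>(1 - k)\<^sup>j\<close>, which
  eventually vanish because \<open>G\<close> is nilpotent.
\<close>

lemma act_cong_1:
  fixes k q :: int
  assumes g: "g \<in> carrier G" and k: "g \<otimes> a \<otimes> inv g = a [^] k"
    and q: "Factorial_Ring.prime q" "q dvd m"
  shows "[k = 1] (mod q)"
proof -
  obtain c where c: "lower_central_series G c = {\<one>}"
    using nil by (auto simp: nilpotent_group_def)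
  have "a [^] ((1 - k) ^ j) \<in> lower_central_series G j" for j
  proof (induction j)
    case 0
    show ?case using a by simp
  next
    case (Suc j)
    define i where "i = (1 - k) ^ j"
    have "g \<otimes> a [^] (- i) \<otimes> inv g = a [^] (- (k * i))"
      unfolding conj_int_pow[OF g a] k using a by (simp add: int_pow_pow)
    then have "a [^] i \<otimes> (g \<otimes> inv (a [^] i) \<otimes> inv g) = a [^] (i - k * i)"
      using a by (simp add: int_pow_neg int_pow_diff)
    then have "a [^] i \<otimes> g \<otimes> inv (a [^] i) \<otimes> inv g = a [^] ((1 - k) ^ Suc j)"
      using a g by (simp add: i_def m_assoc algebra_simps)
    then show ?case
      using lower_central_series_commutator[OF Suc g] by (simp only: i_def)
  qed
  from this[of c] have "a [^] ((1 - k) ^ c) = \<one>" using c by simp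
  then have "q dvd (1 - k) ^ c" using q(2) int_pow_eq_id[OF a] dvd_trans by blast
  then have "q dvd 1 - k" using q(1) prime_dvd_power by blast
  then show ?thesis by (simp add: cong_iff_dvd_diff dvd_diff_commute)
qed

lemma shift_notin_A:
  assumes x: "x \<in> carrier G" "x \<notin> A"
  shows "a [^] (t::int) \<otimes> x \<notin> A"
proof
  assume "a [^] t \<otimes> x \<in> A"
  from subgroup.m_closed[OF subgroup_A subgroup.m_inv_closed[OF subgroup_A pow_mem_A[of t]] this]
  show False using x a by simp
qed

text \<open>The hypotheses of \<open>automorphism_arithmetic\<close> in group terms, modulo the
  order of \<open>a\<close>: \<open>x [^] p\<close> lies in the abelian \<open>A\<close>, so its
  action \<open>k ^ p\<close> is trivial; \<open>x\<close> commutes with \<open>x [^] p\<close>, so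
  \<open>k s = s\<close>; \<open>A\<close> is self-centralizing, so \<open>k\<close> is not 1; and
  an element of order \<open>p\<close> outside \<open>A\<close> contradicts uniqueness.\<close>

lemma outer_action:
  fixes k s :: int and p :: nat
  assumes x: "x \<in> carrier G" "x \<notin> A" and p: "Factorial_Ring.prime p"
    and k: "x \<otimes> a \<otimes> inv x = a [^] k" and s: "x [^] p = a [^] s"
  shows "p = 2 \<and> (\<forall>e m'. m = 2 ^ e * m' \<longrightarrow> odd m' \<longrightarrow>
      e \<ge> 2 \<and> [k = -1] (mod 2 ^ e) \<and> [k = 1] (mod m') \<and> [s = 2 ^ (e - 1)] (mod 2 ^ e))"
proof (rule automorphism_arithmetic[OF p m_positive])
  show "[k = 1] (mod q)" if "Factorial_Ring.prime q" "q dvd m" for q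
    using act_cong_1[OF x(1) k that] .
  have "a [^] s \<otimes> a [^] (1::int) = a [^] (k ^ p * 1) \<otimes> a [^] s"
    using twisted_pow(1)[OF x(1) a k, of p 1] by (simp only: s)
  then have "a [^] (s + 1) = a [^] (k ^ p + s)"
    unfolding int_pow_mult[OF a, symmetric] by simp
  then show "[k ^ p = 1] (mod m)" unfolding int_pow_eq[OF a] by (simp add: cong_iff_dvd_diff)
  have "x \<otimes> x [^] p \<otimes> inv x = x [^] p \<otimes> x \<otimes> inv x"
    using group_commutes_pow[of x x p] x(1) by simp
  also have "\<dots> = x [^] p" using x(1) by (simp add: m_assoc)
  finally have "a [^] s = x \<otimes> a [^] s \<otimes> inv x" by (simp only: s)
  then have "a [^] s = a [^] (k * s)"
    unfolding conj_int_pow[OF x(1) a] k int_pow_pow[OF a] .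
  then show "[k * s = s] (mod m)" unfolding int_pow_eq[OF a] by (simp add: cong_iff_dvd_diff)
  show "\<not> [k = 1] (mod m)"
  proof
    assume "[k = 1] (mod m)"
    then have "a [^] (1::int) = a [^] k" unfolding int_pow_eq[OF a] by (simp add: cong_iff_dvd_diff)
    then have "x \<otimes> a \<otimes> inv x \<otimes> x = a \<otimes> x" using a by (simp add: k)
    then have "x \<otimes> a = a \<otimes> x" using x(1) a by (simp add: m_assoc)
    then show False using central x by blast
  qed
  fix t :: int assume pm: "int p dvd m"
  show "\<not> m dvd s + t * (\<Sum>j<p. k ^ j)"
  proof
    assume "m dvd s + t * (\<Sum>j<p. k ^ j)"
    then have "a [^] (t * (\<Sum>j<p. k ^ j)) \<otimes> a [^] s = \<one>"
      unfolding int_pow_mult[OF a, symmetric] int_pow_eq_id[OF a] by (simp add: add.commute)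
    then have "(a [^] t \<otimes> x) [^] p = \<one>"
      unfolding twisted_pow(2)[OF x(1) a k] s .
    then have "a [^] t \<otimes> x \<in> A"
      using a x(1) p pm by (intro prime_order_mem) simp_all
    then show False using shift_notin_A[OF x] by blast
  qed
qed

section \<open>The index of \<open>A\<close> is at most 2\<close>

lemma outer_prime:
  assumes "x \<in> carrier G" "x \<notin> A" "Factorial_Ring.prime (p::nat)" "x [^] p \<in> A"
  shows "p = 2"
  using outer_action[OF assms(1-3)] act_exists[OF assms(1)] assms(4) A_iff by blast

lemma ord_decomposition:
  obtains e m' :: nat where "ord a = 2 ^ e * m'" "odd m'"
proof -
  have "ord a \<noteq> 0" "\<not> is_unit (2::nat)" using ord_positive[OF a] by simp_all
  then obtain y where "ord a = 2 ^ multiplicity 2 (ord a) * y" "odd y"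
    using multiplicity_decompose'[of "ord a" 2] by blast
  then show thesis by (rule that)
qed

text \<open>If \<open>w [^] 2\<close> were outside \<open>A\<close>, it would invert the 2-part of
  \<open>A\<close>, which has order at least 4. But it acts as the square of the action of
  \<open>w\<close>, and -1 is not a square modulo 4.\<close>

lemma square_square_mem:
  assumes w: "w \<in> carrier G" and mem: "(w [^] (2::nat)) [^] (2::nat) \<in> A"
  shows "w [^] (2::nat) \<in> A"
proof (rule ccontr)
  assume notin: "w [^] (2::nat) \<notin> A"
  obtain e m' where m': "ord a = 2 ^ e * m'" "odd m'" by (rule ord_decomposition)
  obtain l where l: "w \<otimes> a \<otimes> inv w = a [^] (l::int)" using act_exists[OF w] by blast
  obtain s where s: "(w [^] (2::nat)) [^] (2::nat) = a [^] (s::int)" using mem A_iff by blast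
  have w2: "w [^] (2::nat) \<in> carrier G" using w by simp
  have "w [^] (2::nat) \<otimes> a [^] (1::int) \<otimes> inv (w [^] (2::nat))
      = a [^] (l ^ 2 * 1) \<otimes> w [^] (2::nat) \<otimes> inv (w [^] (2::nat))"
    unfolding twisted_pow(1)[OF w a l] ..
  then have k: "w [^] (2::nat) \<otimes> a \<otimes> inv (w [^] (2::nat)) = a [^] (l ^ 2)"
    using w2 a by (simp add: m_assoc)
  have "m = 2 ^ e * int m'" "odd (int m')" using m' by simp_all
  then have "e \<ge> 2" "[l ^ 2 = -1] (mod 2 ^ e)"
    using outer_action[OF w2 notin two_is_prime_nat k s] by blast+
  moreover from this(1) have "(2::int) ^ 2 dvd 2 ^ e" by (rule le_imp_power_dvd)
  ultimately have "4 dvd l ^ 2 + 1" by (auto simp: cong_iff_dvd_diff intro: dvd_trans)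
  moreover have "\<not> 4 dvd l ^ 2 + 1"
  proof (cases "even l")
    case True
    then obtain c where "l = 2 * c" by blast
    then have "l ^ 2 + 1 = 4 * c ^ 2 + 1" by (simp add: power2_eq_square)
    then show ?thesis by presburger
  next
    case False
    then obtain c where "l = 2 * c + 1" by (blast elim: oddE)
    then have "l ^ 2 + 1 = 4 * (c ^ 2 + c) + 2" by (simp add: power2_eq_square algebra_simps)
    then show ?thesis by presburger
  qed
  ultimately show False by blast
qed

text \<open>The order of \<open>y\<close> modulo \<open>A\<close> has no odd prime factor by
  \<open>outer_prime\<close> and no factor 4 by \<open>square_square_mem\<close>. The argument is a
  descent on the exponent that splits two primes off \<open>n\<close>.\<close>

lemma pow_mem_imp_square_mem:
  assumes y: "y \<in> carrier G"
  shows "n > 0 \<Longrightarrow> y [^] (n::nat) \<in> A \<Longrightarrow> y [^] (2::nat) \<in> A"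
proof (induction n rule: less_induct)
  case (less n)
  have two: "r = 2" if "Factorial_Ring.prime (r::nat)" "y [^] q \<notin> A" "y [^] (q * r) \<in> A" for q r
    using outer_prime[of "y [^] q" r] that y by (simp add: nat_pow_pow)
  have IH: "y [^] (2::nat) \<in> A" if "0 < q" "q < n" "y [^] q \<in> A" for q
    using less.IH that by blast
  show ?case
  proof (rule ccontr)
    assume not2: "y [^] (2::nat) \<notin> A"
    have "n \<noteq> 1"
    proof
      assume "n = 1"
      then have "y \<in> A" using less.prems(2) y by simp
      from subgroup.m_closed[OF subgroup_A this this] show False
        using not2 y by (simp add: numeral_2_eq_2)
    qed
    then obtain p where p: "Factorial_Ring.prime p" "p dvd n" using prime_factor_nat by blast
    then obtain q where q: "n = q * p" by (metis dvd_def mult.commute)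
    have "q < n" "q > 0" using q less.prems(1) prime_gt_1_nat[OF p(1)] by auto
    then have qA: "y [^] q \<notin> A" using IH not2 by blast
    then have "p = 2" using two[OF p(1)] less.prems(2) q by simp
    then have n: "n = q * 2" using q by simp
    have "q \<noteq> 1" using not2 less.prems(2) n by auto
    then obtain p' where p': "Factorial_Ring.prime p'" "p' dvd q" using prime_factor_nat by blast
    then obtain q' where q': "q = q' * p'" by (metis dvd_def mult.commute)
    \<comment> \<open>Now \<open>p'\<close> is removed from \<open>n\<close> in place of the factor
      2. The remaining exponent \<open>q' * 2\<close> is again below \<open>n\<close>, so
      \<open>p'\<close> is 2 as well and 4 divides \<open>n\<close>.\<close>
    have q'n: "0 < q' * 2" "q' * 2 < n"
      using q' n \<open>q > 0\<close> prime_gt_1_nat[OF p'(1)] by auto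
    then have "y [^] (q' * 2) \<notin> A" using IH not2 by blast
    moreover have "q' * 2 * p' = n" using n q' by simp
    then have "y [^] (q' * 2 * p') \<in> A" using less.prems(2) by simp
    ultimately have "p' = 2" using two[OF p'(1)] by blast
    then have q2: "q = q' * 2" and n4: "n = q' * 2 * 2" using n q' by simp_all
    have sq: "(y [^] q') [^] (2::nat) = y [^] (q' * 2)" using y by (rule nat_pow_pow)
    have "((y [^] q') [^] (2::nat)) [^] (2::nat) = y [^] n"
      unfolding sq n4 using y by (rule nat_pow_pow)
    then have "((y [^] q') [^] (2::nat)) [^] (2::nat) \<in> A" using less.prems(2) by simp
    then have "(y [^] q') [^] (2::nat) \<in> A" by (rule square_square_mem[rotated]) (use y in simp)
    then show False using qA sq q2 by simp
  qed
qed

lemma square_mem: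
  assumes y: "y \<in> carrier G"
  shows "y [^] (2::nat) \<in> A"
proof -
  have "y [^] ord y \<in> A"
    unfolding pow_ord_eq_1[OF y] by (rule subgroup.one_closed[OF subgroup_A])
  from pow_mem_imp_square_mem[OF y ord_positive[OF y] this] show ?thesis .
qed

lemma outer_involution:
  assumes x: "x \<in> carrier G" "x \<notin> A"
    and m': "ord a = 2 ^ e * m'" "odd m'"
  obtains k s :: int where "x \<otimes> a \<otimes> inv x = a [^] k" "x [^] (2::nat) = a [^] s" "e \<ge> 2"
    "[k = -1] (mod 2 ^ e)" "[k = 1] (mod int m')" "[s = 2 ^ (e - 1)] (mod 2 ^ e)"
proof -
  obtain k where k: "x \<otimes> a \<otimes> inv x = a [^] (k::int)" using act_exists[OF x(1)] by blast
  obtain s where s: "x [^] (2::nat) = a [^] (s::int)" using square_mem[OF x(1)] A_iff by blast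
  have mm: "m = 2 ^ e * int m'" "odd (int m')" using m' by simp_all
  show thesis
    using outer_action[OF x two_is_prime_nat k s, THEN conjunct2, rule_format, OF mm]
    by (elim conjE) (rule that[OF k s])
qed

text \<open>All elements outside \<open>A\<close> act on \<open>A\<close> alike: by inversion on the
  2-part and trivially on the odd part, which determines the action by the Chinese remainder
  theorem. So the quotient of two of them centralizes \<open>a\<close>.\<close>

lemma outer_quotient_mem:
  assumes x: "x \<in> carrier G" "x \<notin> A" and y: "y \<in> carrier G" "y \<notin> A"
  shows "inv x \<otimes> y \<in> A"
proof -
  obtain e m' where m': "ord a = 2 ^ e * m'" "odd m'" by (rule ord_decomposition)
  obtain k s :: int where k: "x \<otimes> a \<otimes> inv x = a [^] k" "[k = -1] (mod 2 ^ e)" "[k = 1] (mod int m')"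
    using outer_involution[OF x m'] by blast
  obtain l s :: int where l: "y \<otimes> a \<otimes> inv y = a [^] l" "[l = -1] (mod 2 ^ e)" "[l = 1] (mod int m')"
    using outer_involution[OF y m'] by blast
  have "coprime (2 ^ e) (int m')" using m'(2) by simp
  then have "[k = l] (mod 2 ^ e * int m')"
    using cong_trans[OF k(2) cong_sym[OF l(2)]] cong_trans[OF k(3) cong_sym[OF l(3)]]
    by (intro coprime_cong_mult)
  then have "a [^] l = a [^] k" unfolding int_pow_eq[OF a] using m'(1) by (simp add: cong_iff_dvd_diff)
  then have eq: "y \<otimes> a \<otimes> inv y = x \<otimes> a \<otimes> inv x" by (simp add: k l)
  have "inv x \<otimes> (y \<otimes> a \<otimes> inv y) \<otimes> y = a \<otimes> (inv x \<otimes> y)"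
    unfolding eq using x y a by (simp add: m_assoc)
  then have "inv x \<otimes> y \<otimes> a = a \<otimes> (inv x \<otimes> y)" using x y a by (simp add: m_assoc)
  then show ?thesis using x y by (intro central) simp_all
qed

end

section \<open>Recognizing generalized quaternion groups\<close>

lemma (in group) commute_int_pow:
  assumes "x \<in> carrier G" "y \<in> carrier G" "x \<otimes> y = y \<otimes> x"
  shows "x \<otimes> y [^] (i::int) = y [^] i \<otimes> x"
proof -
  have "x \<otimes> y \<otimes> inv x = y" using assms by (simp add: m_assoc)
  then have "y [^] i \<otimes> x = x \<otimes> y [^] i \<otimes> inv x \<otimes> x"
    using conj_int_pow[OF assms(1,2), of i] by simp
  then show ?thesis using assms by (simp add: m_assoc)
qed

section \<open>Evaluation of words and maps out of presented groups\<close>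

definition (in group) eval_word :: "('g \<Rightarrow> 'a) \<Rightarrow> 'g word \<Rightarrow> 'a" where
  "eval_word f w = foldr (\<lambda>(x, s) y. (if s then f x else inv f x) \<otimes> y) w \<one>"

lemma (in group) eval_word_simps [simp]:
  "eval_word f [] = \<one>"
  "eval_word f ((x, s) # w) = (if s then f x else inv f x) \<otimes> eval_word f w"
  by (simp_all add: eval_word_def)

lemma (in group) eval_word_closed:
  assumes "\<And>x. f x \<in> carrier G"
  shows "eval_word f w \<in> carrier G"
  by (induction w) (auto simp: assms)

lemma (in group) eval_word_append:
  assumes f: "\<And>x. f x \<in> carrier G"
  shows "eval_word f (u @ v) = eval_word f u \<otimes> eval_word f v"
proof (induction u)
  case Nil
  show ?case using eval_word_closed[of f v, OF f] by simp
next
  case (Cons c u)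
  show ?case
    using eval_word_closed[of f u, OF f] eval_word_closed[of f v, OF f] f
    by (cases c) (simp add: Cons m_assoc)
qed

lemma (in group) eval_word_equiv:
  assumes f: "\<And>x. f x \<in> carrier G"
    and R: "\<And>l r. (l, r) \<in> R \<Longrightarrow> eval_word f l = eval_word f r"
  shows "word_equiv R u v \<Longrightarrow> eval_word f u = eval_word f v"
proof (induction rule: word_equiv.induct)
  case (cancel u x s v)
  have "eval_word f [(x, s), (x, \<not> s)] = \<one>"
    using f by (cases s) simp_all
  moreover have "eval_word f (u @ [(x, s), (x, \<not> s)] @ v)
      = eval_word f u \<otimes> (eval_word f [(x, s), (x, \<not> s)] \<otimes> eval_word f v)"
    by (simp only: eval_word_append[OF f])
  ultimately show ?case
    using eval_word_closed[of f, OF f] by (simp add: eval_word_append[OF f])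
next
  case (rel l r u v)
  then show ?case by (simp add: eval_word_append[OF f] R)
qed simp_all

text \<open>Von Dyck's theorem. An element of the presented group is a set of words on which
  \<open>eval_word f\<close> is constant, so \<open>the_elem\<close> picks out that common
  value.\<close>

lemma (in group) presented_group_hom:
  assumes f: "\<And>x. f x \<in> carrier G"
    and R: "\<And>l r. (l, r) \<in> R \<Longrightarrow> eval_word f l = eval_word f r"
  shows "\<exists>h \<in> hom (presented_group R) G. \<forall>w. h (word_class R w) = eval_word f w"
proof -
  define h where "h Z = the_elem (eval_word f ` Z)" for Z
  have h: "h (word_class R w) = eval_word f w" for w
  proof -
    have "eval_word f v = eval_word f w" if "v \<in> word_class R w" for v
      using eval_word_equiv[OF f R, where u = w and v = v] that by (simp add: word_class_def)
    moreover have "w \<in> word_class R w" by (simp add: word_class_def word_equiv.refl)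
    ultimately have "eval_word f ` word_class R w = {eval_word f w}" by blast
    then show ?thesis by (simp add: h_def)
  qed
  have carrier: "carrier (presented_group R) = range (word_class R)"
    by (simp add: presented_group_def)
  have "h \<in> hom (presented_group R) G"
  proof (rule homI)
    fix Z assume "Z \<in> carrier (presented_group R)"
    then obtain u where u: "Z = word_class R u" unfolding carrier by blast
    show "h Z \<in> carrier G" unfolding u h using f by (rule eval_word_closed)
    fix Y assume "Y \<in> carrier (presented_group R)"
    then obtain v where v: "Y = word_class R v" unfolding carrier by blast
    show "h (Z \<otimes>\<^bsub>presented_group R\<^esub> Y) = h Z \<otimes> h Y"
      unfolding u v presented_group_mult h using f by (rule eval_word_append)
  qed
  then show ?thesis using h by blast
qed

text \<open>This is the induction step over words that brings every element of the presented group
  into the normal form \<open>T\<close>. It works because conjugation by \<open>b\<close> inverts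
  \<open>a\<close> and the square of \<open>b\<close> is a power of \<open>a\<close>, here with an
  arbitrary exponent \<open>N\<close>.\<close>

lemma (in group) quaternion_normal_form_mult:
  fixes N :: nat
  assumes a: "a \<in> carrier G" and b: "b \<in> carrier G"
    and bb: "b \<otimes> b = a [^] N" and ba: "inv b \<otimes> a \<otimes> b = inv a"
  defines "T \<equiv> {a [^] (i::int) \<otimes> b [^] (j::nat) | i j. j < 2}"
  assumes y: "y \<in> T"
  shows "a \<otimes> y \<in> T" "inv a \<otimes> y \<in> T" "b \<otimes> y \<in> T" "inv b \<otimes> y \<in> T"
proof -
  obtain i :: int and j :: nat where ij: "y = a [^] i \<otimes> b [^] j" "j < 2"
    using y by (auto simp: T_def)
  have T: "a [^] k \<otimes> b [^] l \<in> T" if "l < 2" for k :: int and l :: nat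
    using that unfolding T_def by blast
  have aT: "a [^] k \<otimes> z \<in> T" if z: "z \<in> T" for k :: int and z
  proof -
    obtain i :: int and j :: nat where z: "z = a [^] i \<otimes> b [^] j" "j < 2"
      using z by (auto simp: T_def)
    have "a [^] k \<otimes> z = a [^] (k + i) \<otimes> b [^] j"
      using a b z(1) by (simp add: m_assoc int_pow_mult)
    then show ?thesis using T z(2) by simp
  qed
  show "a \<otimes> y \<in> T" using aT[OF y, of 1] a by simp
  show "inv a \<otimes> y \<in> T" using aT[OF y, of "-1"] a by (simp add: int_pow_neg)
  have "b \<otimes> (inv b \<otimes> a \<otimes> b) \<otimes> inv b = a" using a b by (simp add: m_assoc)
  then have "inv (b \<otimes> inv a \<otimes> inv b) = inv a" by (simp add: ba)
  then have "b \<otimes> a \<otimes> inv b = a [^] (- 1 :: int)"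
    using a b by (simp add: inv_mult_group m_assoc int_pow_neg)
  from twisted_pow(1)[OF b a this, of 1]
  have swap: "b \<otimes> a [^] k = a [^] (- k) \<otimes> b" for k :: int using b by simp
  have bT: "b \<otimes> y \<in> T"
  proof (cases "j = 0")
    case True
    have "b \<otimes> y = a [^] (- i) \<otimes> b [^] (1::nat)" using True ij(1) a b by (simp add: swap)
    then show ?thesis using T[of 1 "- i"] by simp
  next
    case False
    then have "j = 1" using ij(2) by simp
    then have "b \<otimes> y = (b \<otimes> a [^] i) \<otimes> b" using ij(1) a b by (simp add: m_assoc)
    also have "\<dots> = a [^] (- i) \<otimes> a [^] N" unfolding swap using a b by (simp add: m_assoc bb)
    also have "\<dots> = a [^] (- i + int N) \<otimes> b [^] (0::nat)"
      using a unfolding int_pow_mult[OF a] by (simp add: int_pow_int)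
    finally show ?thesis using T[of 0 "- i + int N"] by simp
  qed
  then show "b \<otimes> y \<in> T" .
  have yc: "y \<in> carrier G" using ij(1) a b by simp
  \<comment> \<open>Since \<open>b \<otimes> b = a [^] N\<close>, the inverse of \<open>b\<close> is
    \<open>b\<close> multiplied by the power of \<open>a\<close> with exponent \<open>- N\<close>,
    which reduces to the case already done.\<close>
  have "inv b \<otimes> y = a [^] (- int N) \<otimes> (b \<otimes> y)"
  proof -
    have "a [^] N \<otimes> (inv b \<otimes> y) = b \<otimes> y" using b yc by (simp add: bb[symmetric] m_assoc)
    then have "inv (a [^] N) \<otimes> (a [^] N \<otimes> (inv b \<otimes> y)) = inv (a [^] N) \<otimes> (b \<otimes> y)" by simp
    then show ?thesis using a b yc by (simp add: int_pow_neg int_pow_int)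
  qed
  then show "inv b \<otimes> y \<in> T" using aT[OF bT] by simp
qed

text \<open>Von Dyck's theorem for the quaternion relations. The normal form in \<open>Q\<close> is
  stated along with the homomorphism because the kernel is computed from it later.\<close>

lemma (in group) generalized_quaternion_hom:
  fixes n
  defines "Q \<equiv> generalized_quaternion n"
  assumes u: "u \<in> carrier G" and b: "b \<in> carrier G"
    and ub: "u [^] (2 ^ (n - 1) :: nat) = \<one>" "b \<otimes> b = u [^] (2 ^ (n - 2) :: nat)"
      "inv b \<otimes> u \<otimes> b = inv u"
  shows "\<exists>h \<in> hom Q G. \<exists>\<alpha> \<in> carrier Q. \<exists>\<beta> \<in> carrier Q. h \<alpha> = u \<and> h \<beta> = b \<and>
    \<alpha> [^]\<^bsub>Q\<^esub> (2 ^ (n - 1) :: nat) = \<one>\<^bsub>Q\<^esub> \<and>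
    (\<forall>Z \<in> carrier Q. \<exists>i::int. \<exists>j::nat. j < 2 \<and> Z = \<alpha> [^]\<^bsub>Q\<^esub> i \<otimes>\<^bsub>Q\<^esub> \<beta> [^]\<^bsub>Q\<^esub> j)"
proof -
  define R where "R = {(replicate (2 ^ (n - 1)) (gen_a, True), []),
    ([(gen_b, True), (gen_b, True)], replicate (2 ^ (n - 2)) (gen_a, True)),
    ([(gen_b, False), (gen_a, True), (gen_b, True)], [(gen_a, False)])}"
  have Q: "Q = presented_group R"
    by (simp add: Q_def generalized_quaternion_def R_def Let_def)
  interpret Q: group Q unfolding Q by (rule group_presented_group)
  let ?c = "word_class R"
  have carrier: "carrier Q = range ?c" and one: "\<one>\<^bsub>Q\<^esub> = ?c []"
    by (simp_all add: Q presented_group_def)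
  have mult: "?c u \<otimes>\<^bsub>Q\<^esub> ?c v = ?c (u @ v)" for u v
    unfolding Q by (rule presented_group_mult)
  define g where "g x = ?c [(x, True)]" for x
  have g: "g x \<in> carrier Q" for x by (simp add: g_def carrier)
  have rel: "?c l = ?c r" if "(l, r) \<in> R" for l r
    using word_equiv.rel[OF that, of "[]" "[]"] by (simp add: word_class_eq_iff)
  have ginv: "?c [(x, False)] = inv\<^bsub>Q\<^esub> g x" for x
  proof -
    have "?c [(x, False)] \<otimes>\<^bsub>Q\<^esub> g x = \<one>\<^bsub>Q\<^esub>"
      using word_equiv.cancel[of R "[]" x False "[]"] by (simp add: g_def mult one word_class_eq_iff)
    from Q.inv_equality[OF this g] show ?thesis by (simp add: carrier)
  qed
  have gpow: "?c (replicate k (x, True)) = g x [^]\<^bsub>Q\<^esub> k" for k x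
  proof (induction k)
    case 0
    show ?case by (simp add: one)
  next
    case (Suc k)
    have "?c (replicate (Suc k) (x, True)) = ?c (replicate k (x, True)) \<otimes>\<^bsub>Q\<^esub> g x"
      unfolding g_def mult by (simp add: replicate_append_same)
    then show ?case by (simp add: Suc)
  qed
  define \<alpha> where "\<alpha> = g gen_a"
  define \<beta> where "\<beta> = g gen_b"
  have \<alpha>: "\<alpha> \<in> carrier Q" and \<beta>: "\<beta> \<in> carrier Q" by (simp_all add: \<alpha>_def \<beta>_def g)
  have r1: "\<alpha> [^]\<^bsub>Q\<^esub> (2 ^ (n - 1) :: nat) = \<one>\<^bsub>Q\<^esub>"
    unfolding \<alpha>_def gpow[symmetric] one by (rule rel) (simp add: R_def)
  have r2: "\<beta> \<otimes>\<^bsub>Q\<^esub> \<beta> = \<alpha> [^]\<^bsub>Q\<^esub> (2 ^ (n - 2) :: nat)"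
    unfolding \<alpha>_def \<beta>_def gpow[symmetric] unfolding g_def mult by (rule rel) (simp add: R_def)
  have r3: "inv\<^bsub>Q\<^esub> \<beta> \<otimes>\<^bsub>Q\<^esub> \<alpha> \<otimes>\<^bsub>Q\<^esub> \<beta> = inv\<^bsub>Q\<^esub> \<alpha>"
    unfolding \<alpha>_def \<beta>_def ginv[symmetric] unfolding g_def mult by (rule rel) (simp add: R_def)
  define T where "T = {\<alpha> [^]\<^bsub>Q\<^esub> (i::int) \<otimes>\<^bsub>Q\<^esub> \<beta> [^]\<^bsub>Q\<^esub> (j::nat) | i j. j < 2}"
  have nf: "?c w \<in> T" for w
  proof (induction w)
    case Nil
    have "?c [] = \<alpha> [^]\<^bsub>Q\<^esub> (0::int) \<otimes>\<^bsub>Q\<^esub> \<beta> [^]\<^bsub>Q\<^esub> (0::nat)" by (simp add: one[symmetric])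
    then show ?case
      unfolding T_def by (intro CollectI exI[of _ "0::int"] exI[of _ "0::nat"]) simp
  next
    case (Cons c w)
    obtain x s where c: "c = (x, s)" by (cases c)
    have "?c (c # w) = ?c [(x, s)] \<otimes>\<^bsub>Q\<^esub> ?c w" by (simp add: mult c)
    also have "?c [(x, s)] = (if s then g x else inv\<^bsub>Q\<^esub> g x)" by (simp add: ginv g_def)
    finally have eq: "?c (c # w) = (if s then g x else inv\<^bsub>Q\<^esub> g x) \<otimes>\<^bsub>Q\<^esub> ?c w" .
    note nfm = Q.quaternion_normal_form_mult[OF \<alpha> \<beta> r2 r3, folded T_def, OF Cons]
    show ?case
    proof (cases x)
      case gen_a
      then show ?thesis using nfm(1,2) unfolding eq by (simp add: \<alpha>_def)
    next
      case gen_b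
      then show ?thesis using nfm(3,4) unfolding eq by (simp add: \<beta>_def)
    qed
  qed
  define f where "f x = (case x of gen_a \<Rightarrow> u | gen_b \<Rightarrow> b)" for x
  have f: "f x \<in> carrier G" for x using u b by (cases x) (simp_all add: f_def)
  have pow: "eval_word f (replicate k (x, True)) = f x [^] k" for k x
  proof (induction k)
    case 0
    show ?case by simp
  next
    case (Suc k)
    have "f x \<otimes> f x [^] k = f x [^] Suc k" using f by (simp only: nat_pow_Suc2)
    then show ?case using Suc by simp
  qed
  have ev: "eval_word f l = eval_word f r" if "(l, r) \<in> R" for l r
  proof -
    have "inv b \<otimes> (u \<otimes> b) = inv u" using ub(3) u b by (simp add: m_assoc)
    then show ?thesis
      using that ub(1,2) u b unfolding R_def by (elim insertE) (simp_all add: pow f_def)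
  qed
  obtain h where h: "h \<in> hom Q G" and hc: "\<And>w. h (?c w) = eval_word f w"
    using presented_group_hom[OF f ev] unfolding Q by blast
  have h\<alpha>: "h \<alpha> = u" and h\<beta>: "h \<beta> = b"
    unfolding \<alpha>_def \<beta>_def g_def hc using u b by (simp_all add: f_def)
  have "\<exists>i::int. \<exists>j::nat. j < 2 \<and> Z = \<alpha> [^]\<^bsub>Q\<^esub> i \<otimes>\<^bsub>Q\<^esub> \<beta> [^]\<^bsub>Q\<^esub> j" if "Z \<in> carrier Q" for Z
  proof -
    obtain w where "Z = ?c w" using \<open>Z \<in> carrier Q\<close> unfolding carrier by blast
    then show ?thesis using nf[of w] unfolding T_def by blast
  qed
  then show ?thesis by (intro bexI[OF _ h] bexI[OF _ \<alpha>] bexI[OF _ \<beta>] conjI h\<alpha> h\<beta> r1 ballI)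
qed

text \<open>\<open>F\<close> multiplies the image of an element of \<open>Q\<close> by a power of
  \<open>v\<close>; it is a homomorphism because \<open>v\<close> commutes with \<open>u\<close> and
  \<open>b\<close>. In terms of the normal form of \<open>Q\<close>, its bijectivity is read off
  from \<open>surj\<close> and \<open>inj\<close>.\<close>

lemma (in group) quaternion_times_cyclic:
  assumes u: "u \<in> carrier G" and b: "b \<in> carrier G" and v: "v \<in> carrier G"
    and rels: "u [^] (2 ^ (n - 1) :: nat) = \<one>" "b \<otimes> b = u [^] (2 ^ (n - 2) :: nat)"
      "inv b \<otimes> u \<otimes> b = inv u"
    and uv: "u \<otimes> v = v \<otimes> u" and bv: "b \<otimes> v = v \<otimes> b" and odd: "odd (ord v)"
    and surj: "\<And>g. g \<in> carrier G \<Longrightarrow>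
      \<exists>i::int. \<exists>j::nat. \<exists>l::int. j < 2 \<and> g = u [^] i \<otimes> b [^] j \<otimes> v [^] l"
    and inj: "\<And>(i::int) (j::nat) (l::int). j < 2 \<Longrightarrow> u [^] i \<otimes> b [^] j \<otimes> v [^] l = \<one> \<Longrightarrow>
      j = 0 \<and> int (2 ^ (n - 1)) dvd i \<and> v [^] l = \<one>"
  shows "\<exists>C :: 'a monoid. group C \<and> cyclic_group C \<and> odd (order C) \<and>
    G \<cong> generalized_quaternion n \<times>\<times> C"
proof -
  define Q where "Q = generalized_quaternion n"
  define V where "V = generate G {v}"
  \<comment> \<open>A bare record in place of \<open>G\<lparr>carrier := V\<rparr>\<close>, because
    the conclusion asks for the type \<open>'a monoid\<close> and \<open>G\<close> may carry further
    fields.\<close>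
  define C where "C = \<lparr>carrier = V, monoid.mult = (\<otimes>), one = \<one>\<rparr>"
  have V: "subgroup V G" using v by (simp add: V_def generate_is_subgroup)
  have Vc: "c \<in> carrier G" if "c \<in> V" for c using subgroup.mem_carrier[OF V that] .
  have V_iff: "c \<in> V \<longleftrightarrow> (\<exists>l::int. c = v [^] l)" for c
    unfolding V_def using v by (rule generate_singleton_iff)
  have C_simps: "carrier C = V" "\<And>x y. x \<otimes>\<^bsub>C\<^esub> y = x \<otimes> y" "\<one>\<^bsub>C\<^esub> = \<one>"
    by (simp_all add: C_def)
  have C: "group C"
  proof (rule groupI)
    fix x assume x: "x \<in> carrier C"
    then have xV: "x \<in> V" by (simp only: C_simps)
    show "\<exists>y \<in> carrier C. y \<otimes>\<^bsub>C\<^esub> x = \<one>\<^bsub>C\<^esub>"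
      unfolding C_simps using l_inv[OF Vc[OF xV]] by (intro bexI[of _ "inv x"] subgroup.m_inv_closed[OF V xV])
  qed (simp_all add: C_simps subgroup.m_closed[OF V] subgroup.one_closed[OF V] Vc m_assoc)
  have cyc: "cyclic_group C"
  proof (rule group.cyclic_group_epimorphic_image[OF group_subgroup_generated[of "{v}"] _ cyclic_group_generated C])
    have "carrier (subgroup_generated G {v}) = V"
      using v by (simp add: carrier_subgroup_generated V_def)
    then show "id \<in> epi (subgroup_generated G {v}) C"
      by (simp add: epi_def hom_def C_simps)
  qed
  have ordC: "odd (order C)"
    using odd unfolding order_def C_simps V_def generate_pow_card[OF v] .
  from generalized_quaternion_hom[OF u b rels, folded Q_def]
  obtain h \<alpha> \<beta> where h: "h \<in> hom Q G" and \<alpha>: "\<alpha> \<in> carrier Q" and \<beta>: "\<beta> \<in> carrier Q"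
    and conj: "h \<alpha> = u \<and> h \<beta> = b \<and> \<alpha> [^]\<^bsub>Q\<^esub> (2 ^ (n - 1) :: nat) = \<one>\<^bsub>Q\<^esub> \<and>
      (\<forall>Z \<in> carrier Q. \<exists>i::int. \<exists>j::nat. j < 2 \<and> Z = \<alpha> [^]\<^bsub>Q\<^esub> i \<otimes>\<^bsub>Q\<^esub> \<beta> [^]\<^bsub>Q\<^esub> j)"
    by (elim bexE) (rule that)
  have h\<alpha>: "h \<alpha> = u" and h\<beta>: "h \<beta> = b" and \<alpha>_pow: "\<alpha> [^]\<^bsub>Q\<^esub> (2 ^ (n - 1) :: nat) = \<one>\<^bsub>Q\<^esub>"
    by (rule conj[THEN conjunct1] conj[THEN conjunct2, THEN conjunct1]
        conj[THEN conjunct2, THEN conjunct2, THEN conjunct1])+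
  have nf: "\<exists>i::int. \<exists>j::nat. j < 2 \<and> Z = \<alpha> [^]\<^bsub>Q\<^esub> i \<otimes>\<^bsub>Q\<^esub> \<beta> [^]\<^bsub>Q\<^esub> j" if "Z \<in> carrier Q" for Z
    using conj[THEN conjunct2, THEN conjunct2, THEN conjunct2] that by (rule bspec)
  have grQ: "group Q"
    unfolding Q_def generalized_quaternion_def Let_def by (rule group_presented_group)
  interpret Q: group Q by (rule grQ)
  interpret h: group_hom Q G h
    using h grQ is_group by (simp add: group_hom_def group_hom_axioms_def)
  have h_nf: "h (\<alpha> [^]\<^bsub>Q\<^esub> i \<otimes>\<^bsub>Q\<^esub> \<beta> [^]\<^bsub>Q\<^esub> j) = u [^] i \<otimes> b [^] j" for i :: int and j :: nat
    using \<alpha> \<beta> by (simp add: h.hom_int_pow h.hom_nat_pow h\<alpha> h\<beta>)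
  have comm: "c \<otimes> h Z = h Z \<otimes> c" if Z: "Z \<in> carrier Q" and c: "c \<in> V" for Z c
  proof -
    obtain l :: int where l: "c = v [^] l" using c V_iff by blast
    obtain i :: int and j :: nat where ij: "Z = \<alpha> [^]\<^bsub>Q\<^esub> i \<otimes>\<^bsub>Q\<^esub> \<beta> [^]\<^bsub>Q\<^esub> j" using nf[OF Z] by blast
    have cc: "c \<in> carrier G" using Vc[OF c] .
    have "c \<otimes> u = u \<otimes> c" unfolding l by (rule commute_int_pow[OF u v uv, symmetric])
    then have cu: "c \<otimes> u [^] i = u [^] i \<otimes> c" by (rule commute_int_pow[OF cc u])
    have "b \<otimes> c = c \<otimes> b" unfolding l by (rule commute_int_pow[OF b v bv])
    then have cb: "b [^] j \<otimes> c = c \<otimes> b [^] j" using b cc by (rule group_commutes_pow)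
    have "c \<otimes> (u [^] i \<otimes> b [^] j) = (c \<otimes> u [^] i) \<otimes> b [^] j" using cc u b by (simp add: m_assoc)
    also have "\<dots> = u [^] i \<otimes> (b [^] j \<otimes> c)" unfolding cu cb using cc u b by (simp add: m_assoc)
    finally have "c \<otimes> (u [^] i \<otimes> b [^] j) = (u [^] i \<otimes> b [^] j) \<otimes> c"
      using cc u b by (simp add: m_assoc)
    then show ?thesis by (simp add: ij h_nf)
  qed
  define F where "F p = h (fst p) \<otimes> snd p" for p
  have grD: "group (Q \<times>\<times> C)" using grQ C by (rule DirProd_group)
  have F_hom: "F \<in> hom (Q \<times>\<times> C) G"
  proof (rule homI)
    fix p assume "p \<in> carrier (Q \<times>\<times> C)"
    then have p: "fst p \<in> carrier Q" "snd p \<in> V" by (auto simp: C_simps)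
    then show "F p \<in> carrier G" by (simp add: F_def Vc)
    fix q assume "q \<in> carrier (Q \<times>\<times> C)"
    then have q: "fst q \<in> carrier Q" "snd q \<in> V" by (auto simp: C_simps)
    have "F (p \<otimes>\<^bsub>Q \<times>\<times> C\<^esub> q) = h (fst p) \<otimes> (h (fst q) \<otimes> snd p) \<otimes> snd q"
      using p q by (simp add: F_def mult_DirProd' C_simps m_assoc Vc)
    also have "\<dots> = F p \<otimes> F q"
      unfolding comm[OF q(1) p(2), symmetric] using p q by (simp add: F_def m_assoc Vc)
    finally show "F (p \<otimes>\<^bsub>Q \<times>\<times> C\<^esub> q) = F p \<otimes> F q" .
  qed
  interpret F: group_hom "Q \<times>\<times> C" G F
    using grD is_group F_hom by (simp add: group_hom_def group_hom_axioms_def)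
  have ker: "p = \<one>\<^bsub>Q \<times>\<times> C\<^esub>" if p: "p \<in> carrier (Q \<times>\<times> C)" and Fp: "F p = \<one>" for p
  proof -
    have p': "fst p \<in> carrier Q" "snd p \<in> V" using p by (auto simp: C_simps)
    obtain l :: int where l: "snd p = v [^] l" using p'(2) V_iff by blast
    obtain i :: int and j :: nat where j: "j < 2" and ij: "fst p = \<alpha> [^]\<^bsub>Q\<^esub> i \<otimes>\<^bsub>Q\<^esub> \<beta> [^]\<^bsub>Q\<^esub> j"
      using nf[OF p'(1)] by blast
    have "u [^] i \<otimes> b [^] j \<otimes> v [^] l = \<one>" using Fp by (simp only: F_def l ij h_nf)
    from inj[OF j this] have j0: "j = 0" and i: "int (2 ^ (n - 1)) dvd i" and l1: "v [^] l = \<one>" by blast+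
    have "Q.ord \<alpha> dvd 2 ^ (n - 1)" using \<alpha>_pow Q.pow_eq_id[OF \<alpha>] by blast
    then have "int (Q.ord \<alpha>) dvd i" using i by (meson dvd_trans int_dvd_int_iff)
    then have "\<alpha> [^]\<^bsub>Q\<^esub> i = \<one>\<^bsub>Q\<^esub>" using Q.int_pow_eq_id[OF \<alpha>] by blast
    then have "fst p = \<one>\<^bsub>Q\<^esub>" by (simp add: ij j0)
    moreover have "snd p = \<one>\<^bsub>C\<^esub>" by (simp add: l l1 C_simps)
    ultimately show ?thesis by (simp add: prod_eq_iff)
  qed
  have "inj_on F (carrier (Q \<times>\<times> C))"
  proof (rule F.trivial_ker_imp_inj)
    show "kernel (Q \<times>\<times> C) G F = {\<one>\<^bsub>Q \<times>\<times> C\<^esub>}"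
      unfolding kernel_def
    proof (intro equalityI subsetI)
      show "p \<in> {\<one>\<^bsub>Q \<times>\<times> C\<^esub>}" if "p \<in> {p \<in> carrier (Q \<times>\<times> C). F p = \<one>}" for p
        using ker[of p] that by blast
      show "p \<in> {p \<in> carrier (Q \<times>\<times> C). F p = \<one>}" if "p \<in> {\<one>\<^bsub>Q \<times>\<times> C\<^esub>}" for p
        using that F.hom_one F.G.one_closed by blast
    qed
  qed
  moreover have "F ` carrier (Q \<times>\<times> C) = carrier G"
  proof
    show "F ` carrier (Q \<times>\<times> C) \<subseteq> carrier G" using F.hom_closed by blast
    show "carrier G \<subseteq> F ` carrier (Q \<times>\<times> C)"
    proof
      fix g assume "g \<in> carrier G"
      then obtain i :: int and j :: nat and l :: int where g: "g = u [^] i \<otimes> b [^] j \<otimes> v [^] l"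
        using surj by blast
      let ?p = "(\<alpha> [^]\<^bsub>Q\<^esub> i \<otimes>\<^bsub>Q\<^esub> \<beta> [^]\<^bsub>Q\<^esub> j, v [^] l)"
      have "g = F ?p" by (simp add: g F_def h_nf)
      moreover have "?p \<in> carrier (Q \<times>\<times> C)" using \<alpha> \<beta> V_iff by (auto simp: C_simps)
      ultimately show "g \<in> F ` carrier (Q \<times>\<times> C)" by (rule image_eqI)
    qed
  qed
  ultimately have "F \<in> iso (Q \<times>\<times> C) G" using F_hom by (simp add: iso_def bij_betw_def)
  then have "Q \<times>\<times> C \<cong> G" unfolding is_iso_def by blast
  from group.iso_sym[OF grD this] have "G \<cong> Q \<times>\<times> C" .
  then show ?thesis using C cyc ordC unfolding Q_def by blast
qed

section \<open>The case of index 2\<close>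

context self_centralizing_cyclic
begin

text \<open>Here \<open>u\<close> generates the 2-part of \<open>A\<close>, \<open>v\<close> the odd
  part, and \<open>b = a [^] t \<otimes> x\<close> is a shift of the outer element whose square lies
  in the 2-part. As \<open>u\<close> has order \<open>2 ^ e\<close>, the quaternion group belongs to
  \<open>n = Suc e\<close>, and \<open>e \<ge> 2\<close> gives \<open>n \<ge> 3\<close>.\<close>

lemma quaternion_times_cyclic_if_not_cyclic:
  assumes "carrier G \<noteq> A"
  shows "\<exists>n (C :: 'a monoid). n \<ge> 3 \<and> group C \<and> cyclic_group C \<and> odd (order C) \<and>
    G \<cong> generalized_quaternion n \<times>\<times> C"
proof -
  obtain x where x: "x \<in> carrier G" "x \<notin> A"
    using assms subgroup.subset[OF subgroup_A] by blast
  obtain e m' where m': "ord a = 2 ^ e * m'" "odd m'" by (rule ord_decomposition)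
  have m: "m = 2 ^ e * int m'" using m'(1) by simp
  have cop: "coprime (2 ^ e) (int m')" using m'(2) by simp
  obtain k s :: int where k: "x \<otimes> a \<otimes> inv x = a [^] k" and s: "x [^] (2::nat) = a [^] s"
    and e: "e \<ge> 2" and k1: "[k = -1] (mod 2 ^ e)" "[k = 1] (mod int m')"
    and s1: "[s = 2 ^ (e - 1)] (mod 2 ^ e)"
    using outer_involution[OF x m'] by blast
  \<comment> \<open>Modulo \<open>m'\<close> the factor \<open>1 + k\<close> is 2, a unit since
    \<open>m'\<close> is odd. So \<open>t\<close> can be chosen to make
    \<open>s + t * (1 + k)\<close>, the exponent of the square of \<open>b\<close>, divisible by
    \<open>m'\<close>.\<close>
  have copk: "gcd (1 + k) (int m') dvd s"
  proof -
    have "[1 + k = 1 + 1] (mod int m')" using k1(2) by (rule cong_add[OF cong_refl])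
    then have "coprime (1 + k) (int m')" using m'(2) by (simp add: cong_imp_coprime[OF cong_sym])
    then show ?thesis by simp
  qed
  then obtain t where t: "int m' dvd s + t * (1 + k)" using linear_cong_solvable by blast
  define b where "b = a [^] t \<otimes> x"
  define u where "u = a [^] int m'"
  define v where "v = a [^] (2 ^ e :: int)"
  have b: "b \<in> carrier G" and u: "u \<in> carrier G" and v: "v \<in> carrier G"
    using a x by (simp_all add: b_def u_def v_def)
  have bA: "b \<notin> A" unfolding b_def by (rule shift_notin_A[OF x])
  have ba: "b \<otimes> a \<otimes> inv b = a [^] k"
  proof -
    have "b \<otimes> a \<otimes> inv b = a [^] t \<otimes> (x \<otimes> a \<otimes> inv x) \<otimes> inv (a [^] t)"
      using a x(1) by (simp add: b_def inv_mult_group m_assoc)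
    also have "\<dots> = a [^] (t + k) \<otimes> inv (a [^] t)"
      unfolding k using a by (simp add: int_pow_mult)
    also have "\<dots> = a [^] (t + k - t)" using a by (simp only: int_pow_diff)
    finally show ?thesis by simp
  qed
  have b2: "b [^] (2::nat) = a [^] (s + t * (1 + k))"
  proof -
    have sum: "(\<Sum>j<2. k ^ j) = 1 + k" by (simp add: numeral_2_eq_2)
    have "b [^] (2::nat) = a [^] (t * (1 + k)) \<otimes> a [^] s"
      unfolding b_def twisted_pow(2)[OF x(1) a k] s sum ..
    then show ?thesis unfolding int_pow_mult[OF a, symmetric] by (simp only: add.commute)
  qed
  have bpow: "b \<otimes> a [^] i \<otimes> inv b = a [^] (k * i)" for i :: int
    unfolding conj_int_pow[OF b a] ba using a by (rule int_pow_pow)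
  have upow: "u [^] i = a [^] (int m' * i)" for i :: int
    unfolding u_def using a by (rule int_pow_pow)
  have vpow: "v [^] i = a [^] (2 ^ e * i)" for i :: int
    unfolding v_def using a by (rule int_pow_pow)
  have e1: "(2::int) ^ e = 2 ^ (e - 1) * 2" using e by (simp add: power_eq_if)
  have rel1: "u [^] (2 ^ (Suc e - 1) :: nat) = \<one>"
  proof -
    have "u [^] (2 ^ e :: int) = \<one>"
      unfolding upow int_pow_eq_id[OF a] m by (simp add: mult.commute)
    then show ?thesis using int_pow_int[of G u "2 ^ e"] by simp
  qed
  have rel2: "b \<otimes> b = u [^] (2 ^ (Suc e - 2) :: nat)"
  proof -
    \<comment> \<open>Both exponents vanish modulo \<open>m'\<close>. Modulo \<open>2 ^ e\<close>
      the first is \<open>2 ^ (e - 1)\<close> because \<open>m'\<close> is odd, the second because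
      \<open>1 + k\<close> vanishes and \<open>s\<close> is \<open>2 ^ (e - 1)\<close>.\<close>
    have "2 ^ e dvd int m' * 2 ^ (e - 1) - (s + t * (1 + k))"
    proof -
      have "2 ^ e dvd (int m' - 1) * 2 ^ (e - 1)"
      proof -
        have "2 dvd int m' - 1" using m'(2) by simp
        then have "2 ^ (e - 1) * 2 dvd 2 ^ (e - 1) * (int m' - 1)" by (rule mult_dvd_mono[OF dvd_refl])
        then show ?thesis by (simp only: e1 mult.commute[of "int m' - 1"])
      qed
      moreover have "2 ^ e dvd 2 ^ (e - 1) - s" using s1 by (simp add: cong_iff_dvd_diff dvd_diff_commute)
      ultimately have "2 ^ e dvd (int m' - 1) * 2 ^ (e - 1) + (2 ^ (e - 1) - s)" by (rule dvd_add)
      moreover have "2 ^ e dvd t * (1 + k)" using k1(1) by (simp add: cong_iff_dvd_diff add.commute)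
      ultimately have "2 ^ e dvd (int m' - 1) * 2 ^ (e - 1) + (2 ^ (e - 1) - s) - t * (1 + k)"
        by (rule dvd_diff)
      then show ?thesis by (simp add: algebra_simps)
    qed
    moreover have "int m' dvd int m' * 2 ^ (e - 1) - (s + t * (1 + k))" using t by (intro dvd_diff) simp_all
    ultimately have "m dvd int m' * 2 ^ (e - 1) - (s + t * (1 + k))"
      unfolding m using cop by (intro divides_mult)
    then have "b [^] (2::nat) = u [^] (2 ^ (e - 1) :: int)" unfolding b2 upow int_pow_eq[OF a] .
    then show ?thesis using int_pow_int[of G u "2 ^ (e - 1)"] b by (simp add: numeral_2_eq_2)
  qed
  have rel3: "inv b \<otimes> u \<otimes> b = inv u"
  proof -
    have "m dvd - int m' - k * int m'"
    proof -
      have "2 ^ e dvd k + 1" using k1(1) by (simp add: cong_iff_dvd_diff)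
      then have "2 ^ e * int m' dvd (k + 1) * int m'" by (rule mult_dvd_mono) simp
      then have "2 ^ e * int m' dvd - ((k + 1) * int m')" by (simp only: dvd_minus_iff)
      then show ?thesis unfolding m by (simp add: algebra_simps)
    qed
    then have "a [^] (k * int m') = a [^] (- int m')" unfolding int_pow_eq[OF a] .
    then have "b \<otimes> u \<otimes> inv b = inv u" using bpow[of "int m'"] a by (simp add: u_def int_pow_neg)
    then have "inv b \<otimes> (b \<otimes> u \<otimes> inv b) \<otimes> b = inv b \<otimes> inv u \<otimes> b" by simp
    then have "u = inv b \<otimes> inv u \<otimes> b" using b u by (simp add: m_assoc)
    then have "inv u = inv (inv b \<otimes> inv u \<otimes> b)" by simp
    then show ?thesis using b u by (simp add: inv_mult_group m_assoc)
  qed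
  have uv: "u \<otimes> v = v \<otimes> u"
    unfolding u_def v_def int_pow_mult[OF a, symmetric] by (simp add: add.commute)
  have bv: "b \<otimes> v = v \<otimes> b"
  proof -
    have "int m' dvd 1 - k" using k1(2) by (simp add: cong_iff_dvd_diff dvd_diff_commute)
    then have "m dvd 2 ^ e * (1 - k)" unfolding m by (intro mult_dvd_mono) simp_all
    then have "m dvd 2 ^ e - k * 2 ^ e" by (simp add: algebra_simps)
    then have "a [^] (k * 2 ^ e) = a [^] (2 ^ e :: int)" unfolding int_pow_eq[OF a] .
    then have "b \<otimes> v \<otimes> inv b \<otimes> b = v \<otimes> b" using bpow[of "2 ^ e"] by (simp add: v_def)
    then show ?thesis using b v by (simp add: m_assoc)
  qed
  have odd: "odd (ord v)"
  proof -
    have "v = a [^] (2 ^ e :: nat)" using int_pow_int[of G a "2 ^ e"] by (simp add: v_def)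
    then have "ord v = ord a div 2 ^ e" using ord_pow[OF a, of "2 ^ e"] m'(1) by simp
    then show ?thesis using m' by simp
  qed
  have A_form: "\<exists>i::int. \<exists>l::int. y = u [^] i \<otimes> v [^] l" if y: "y \<in> A" for y
  proof -
    obtain i :: int where i: "y = a [^] i" using y A_iff by blast
    obtain c d where cd: "c * int m' + d * 2 ^ e = 1"
      using bezout_int[of "int m'" "2 ^ e"] cop by (auto simp: gcd.commute)
    have "int m' * (i * c) + 2 ^ e * (i * d) = i * (c * int m' + d * 2 ^ e)"
      by (simp add: algebra_simps)
    then have "y = u [^] (i * c) \<otimes> v [^] (i * d)"
      unfolding upow vpow int_pow_mult[OF a, symmetric] by (simp add: i cd)
    then show ?thesis by blast
  qed
  have "\<exists>C :: 'a monoid. group C \<and> cyclic_group C \<and> odd (order C) \<and>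
      G \<cong> generalized_quaternion (Suc e) \<times>\<times> C"
  proof (rule quaternion_times_cyclic[OF u b v rel1 rel2 rel3 uv bv odd])
    fix g assume g: "g \<in> carrier G"
    show "\<exists>i::int. \<exists>j::nat. \<exists>l::int. j < 2 \<and> g = u [^] i \<otimes> b [^] j \<otimes> v [^] l"
    proof (cases "g \<in> A")
      case True
      then obtain i l :: int where "g = u [^] i \<otimes> v [^] l" using A_form by blast
      then have "g = u [^] i \<otimes> b [^] (0::nat) \<otimes> v [^] l" using u by simp
      then show ?thesis by (intro exI[of _ i] exI[of _ "0::nat"] exI[of _ l]) simp
    next
      case False
      \<comment> \<open>\<open>outer_quotient_mem\<close> puts \<open>inv b \<otimes> g\<close> into
        \<open>A\<close>; conjugation by \<open>b\<close> turns it into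
        \<open>g \<otimes> inv b\<close>, which fits the required form with \<open>b\<close> to the
        right of \<open>u\<close>.\<close>
      have "b \<otimes> (inv b \<otimes> g) \<otimes> inv b \<in> A"
        by (rule normal.inv_op_closed2[OF normal_A b outer_quotient_mem[OF b bA g False]])
      then have "g \<otimes> inv b \<in> A" using b g by simp
      then obtain i l :: int where il: "g \<otimes> inv b = u [^] i \<otimes> v [^] l" using A_form by blast
      have "g = g \<otimes> inv b \<otimes> b" using g b by (simp add: m_assoc)
      also have "\<dots> = u [^] i \<otimes> (b \<otimes> v [^] l)"
        unfolding il commute_int_pow[OF b v bv] using u v b by (simp add: m_assoc)
      finally have "g = u [^] i \<otimes> b [^] (1::nat) \<otimes> v [^] l" using u b v by (simp add: m_assoc)
      then show ?thesis by (intro exI[of _ i] exI[of _ "1::nat"] exI[of _ l]) simp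
    qed
  next
    fix i :: int and j :: nat and l :: int
    assume j: "j < 2" and one: "u [^] i \<otimes> b [^] j \<otimes> v [^] l = \<one>"
    have j0: "j = 0"
    proof (rule ccontr)
      assume "j \<noteq> 0"
      then have "j = 1" using j by simp
      then have "(u [^] i \<otimes> v [^] l) \<otimes> b = \<one>"
        using one u v b by (simp add: m_assoc commute_int_pow[OF b v bv])
      then have "inv b = u [^] i \<otimes> v [^] l" using u v b by (intro inv_equality) simp_all
      then have "inv b \<in> A" unfolding upow vpow int_pow_mult[OF a, symmetric] using pow_mem_A by simp
      then have "inv (inv b) \<in> A" by (rule subgroup.m_inv_closed[OF subgroup_A])
      then show False using bA b by simp
    qed
    then have "a [^] (int m' * i + 2 ^ e * l) = \<one>"
      using one u by (simp add: upow vpow int_pow_mult a)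
    then have d: "2 ^ e * int m' dvd int m' * i + 2 ^ e * l" unfolding int_pow_eq_id[OF a] m .
    have "2 ^ e dvd int m' * i" using dvd_mult_left[OF d] by (simp add: dvd_add_left_iff)
    then have i: "2 ^ e dvd i" using cop by (simp add: coprime_dvd_mult_right_iff)
    have "int m' dvd 2 ^ e * l" using dvd_mult_right[OF d] by (simp add: dvd_add_right_iff)
    then have "int m' dvd l" using cop by (simp add: coprime_dvd_mult_right_iff coprime_commute)
    then have "v [^] l = \<one>" unfolding vpow int_pow_eq_id[OF a] m by (intro mult_dvd_mono) simp_all
    then show "j = 0 \<and> int (2 ^ (Suc e - 1)) dvd i \<and> v [^] l = \<one>" using j0 i by simp
  qed
  then show ?thesis using e by (intro exI[of _ "Suc e"]) auto
qed

end

theorem corollary3p2: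
  fixes G :: "('a, 'b) monoid_scheme"
  assumes "group G" and "finite (carrier G)" and "\<not> trivial_group G"
    and "nilpotent_group G" and "totally_2_closed G"
  shows "cyclic_group G \<or>
    (\<exists>n (C :: 'a monoid). n \<ge> 3 \<and> group C \<and> cyclic_group C \<and> odd (order C) \<and>
       G \<cong> generalized_quaternion n \<times>\<times> C)"
proof -
  interpret group G by fact
  interpret unique_prime_subgroups G
    using assms(2,4) prime_order_generate[OF assms(4,5)] by unfold_locales
  obtain a where a: "a \<in> carrier G" "generate G {a} \<lhd> G"
    "\<And>x. x \<in> carrier G \<Longrightarrow> x \<otimes>\<^bsub>G\<^esub> a = a \<otimes>\<^bsub>G\<^esub> x \<Longrightarrow> x \<in> generate G {a}"
    by (rule exists_self_centralizing_cyclic) blast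
  interpret self_centralizing_cyclic G a
    by (rule self_centralizing_cyclic.intro[OF unique_prime_subgroups_axioms
          self_centralizing_cyclic_axioms.intro[OF a]])
  show ?thesis
  proof (cases "carrier G = generate G {a}")
    case True
    then have "carrier G = range (\<lambda>i::int. a [^]\<^bsub>G\<^esub> i)" using generate_pow[OF a(1)] by auto
    then show ?thesis using cyclic_group a(1) by blast
  next
    case False
    then show ?thesis using quaternion_times_cyclic_if_not_cyclic by blast
  qed
qed

end
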